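(* Let $f = f_{0}+\sum_{j=1}^n f_{\alpha(j)} x^{\alpha(j)} +\sum_{\alpha \in \Delta(f)} f_\alpha x^\alpha\in\mathbb{R}[x_1,\dots,x_n]$ be an ST-polynomial in standard form such that every $\alpha\in\Delta(f)$ lies in the interior of $\mathrm{New}(f)$. Suppose there exists $v\in (\mathbb{R}\setminus\{0\})^n$ such that $f_\alpha v^\alpha <0$ for all $\alpha\in \Delta(f)$. (1) Then $f_{\mathrm{gp}}=f^*$. (2) If additionally $\Delta(f) \subseteq \mathrm{New}(f)^*$, then $f_{\mathrm{sos}} = f^*$.
   Context: Notation: $\mathbb{N}$ contains $0$; $x^\alpha = x_1^{\alpha_1}\cdots x_n^{\alpha_n}$; $\mathrm{New}(f)$ is the Newton polytope (convex hull of the exponents with nonzero coefficient), $V(f)$ its vertex set. A polynomial is nonnegative if it is $\geq 0$ on all of $\mathbb{R}^n$. Infima and suprema are in $\mathbb{R}\cup\{\pm\infty\}$. An ST-polynomial in standard form is a polynomial $f = f_{\alpha(0)}+\sum_{j=1}^n f_{\alpha(j)} x^{\alpha(j)} +\sum_{\alpha \in \Delta} f_\alpha x^\alpha$ such that: (ST1) $\alpha(0)=0$ and $\alpha(1),\ldots,\alpha(n)$ form a set $V$ of affinely independent points in $(2\mathbb{N})^n$. (ST2) $\Delta$ is the set of exponents $\alpha$ in $f$ not defining monomial squares, i.e. $\alpha\in\Delta$ iff $f_\alpha<0$, or $\alpha\notin(2\mathbb{N})^n$ and $f_\alpha>0$. (ST3) $\Delta\subseteq \mathrm{conv}(V)$;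 equivalently every $\alpha\in\Delta$ is uniquely written $\alpha=\sum_{j=0}^n\lambda_j^{(\alpha)}\alpha(j)$ with $\lambda_j^{(\alpha)}\ge 0$, $\sum_{j=0}^n\lambda_j^{(\alpha)}=1$. (ST4) $f_0 = f_{\alpha(0)},f_{\alpha(1)},\ldots,f_{\alpha(n)}$ are nonnegative, and if $f_{\alpha(j)}=0$ then $\lambda_j^{(\alpha)}=0$ for all $\alpha\in\Delta$. One writes $\Delta(f)=\Delta$ and $\mathrm{nz}(\alpha)=\{j\in\{0,\ldots,n\}:\lambda_j^{(\alpha)}\neq 0\}$. A circuit polynomial is an ST-polynomial whose set $\Delta$ is empty or a singleton. $f^*=\inf\{f(x):x\in\mathbb{R}^n\}$, and $f_{\mathrm{sos}}$ is the supremum of all $\lambda\in\mathbb{R}$ such that $f-\lambda$ is a finite sum of squares of polynomials in $\mathbb{R}[x_1,\dots,x_n]$. $f_{\mathrm{gp}}$ is the common value of the following two quantities (equal by a theorem of the paper): (A) the supremum of all $r\in\mathbb{R}$ such that $f-r$ is a finite sum of nonnegative circuit polynomials whose Newton polytopes are faces of $\mathrm{conv}(\{0\}\cup V(f))$; (B) the supremum of all $r\in\mathbb{R}$ for which there exist reals $a_{\alpha,j}\ge 0$, $(\alpha,j)\in\Delta(f)\times\{1,\dots,n\}$, with: $a_{\alpha,j}>0$ whenever $\lambda_j^{(\alpha)}>0$; $|f_\alpha| \leq \prod_{j\in \mathrm{nz}(\alpha), j\geq 1} (a_{\alpha,j}/\lambda_j^{(\alpha)})^{\lambda_j^{(\alpha)}}$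 for every $\alpha\in\Delta(f)$ with $\lambda_0^{(\alpha)}=0$; $f_{\alpha(j)}\ge\sum_{\alpha\in\Delta(f)}a_{\alpha,j}$ for $j=1,\dots,n$; and $f_0-r \geq \sum_{\alpha \in \Delta(f), 0 \in \mathrm{nz}(\alpha)} \lambda_0^{(\alpha)} |f_\alpha|^{1/\lambda_0^{(\alpha)}} \prod_{j\in \mathrm{nz}(\alpha), j\geq 1} (\lambda_j^{(\alpha)}/a_{\alpha,j})^{\lambda_j^{(\alpha)}/\lambda_0^{(\alpha)}}$. For a set $L\subseteq\mathbb{Z}^n$ put $\bar A(L)=\{\frac12(s+t): s,t\in L\cap(2\mathbb{Z})^n,\ s\ne t\}$. For a finite set $P\subset(2\mathbb{Z})^n$ put $P^0=\mathrm{conv}(P)\cap\mathbb{Z}^n$ and $P^{k+1}=\bar A(P^k)\cup P$; this decreasing sequence of finite sets becomes stationary, and its stationary value is denoted $P^*$. $\mathrm{New}(f)^*$ denotes $V(f)^*$. *)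

theory Defs
  imports "HOL-Analysis.Analysis" "HOL-Library.Poly_Mapping"
begin

section \<open>Real polynomials in finitely many variables\<close>

text \<open>
  A polynomial in \<open>CARD('n)\<close> variables is the finitely supported map taking an exponent vector to
  its coefficient; the ring structure is the convolution product of \<^theory>\<open>HOL-Library.Poly_Mapping\<close>.
\<close>

type_synonym 'n rpoly = "(nat ^ 'n) \<Rightarrow>\<^sub>0 real"

abbreviation mcoeff :: "'n::finite rpoly \<Rightarrow> nat ^ 'n \<Rightarrow> real" where
  "mcoeff f \<beta> \<equiv> Poly_Mapping.lookup f \<beta>"

abbreviation const_poly :: "real \<Rightarrow> 'n::finite rpoly" where
  "const_poly r \<equiv> Poly_Mapping.single 0 r"

definition mono_eval :: "real ^ 'n::finite \<Rightarrow> nat ^ 'n \<Rightarrow> real" where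
  "mono_eval x \<beta> = (\<Prod>i\<in>UNIV. (x $ i) ^ (\<beta> $ i))"

definition poly_eval :: "'n::finite rpoly \<Rightarrow> real ^ 'n \<Rightarrow> real" where
  "poly_eval f x = (\<Sum>\<beta>\<in>Poly_Mapping.keys f. mcoeff f \<beta> * mono_eval x \<beta>)"

definition nonneg_poly :: "'n::finite rpoly \<Rightarrow> bool" where
  "nonneg_poly f \<longleftrightarrow> (\<forall>x. poly_eval f x \<ge> 0)"

definition rvec :: "nat ^ 'n \<Rightarrow> real ^ 'n::finite" where
  "rvec \<beta> = (\<chi> i. real (\<beta> $ i))"

definition even_vec :: "nat ^ 'n::finite \<Rightarrow> bool" where
  "even_vec \<beta> \<longleftrightarrow> (\<forall>i. even (\<beta> $ i))"

definition newton :: "'n::finite rpoly \<Rightarrow> (real ^ 'n) set" where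
  "newton f = convex hull (rvec ` Poly_Mapping.keys f)"

definition newton_vertices :: "'n::finite rpoly \<Rightarrow> (real ^ 'n) set" where
  "newton_vertices f = {x. x extreme_point_of newton f}"


section \<open>ST-polynomials\<close>

text \<open>The exponents of \<open>f\<close> that do not define monomial squares.\<close>

definition Delta :: "'n::finite rpoly \<Rightarrow> (nat ^ 'n) set" where
  "Delta f = {\<beta>. mcoeff f \<beta> < 0 \<or> (\<not> even_vec \<beta> \<and> mcoeff f \<beta> > 0)}"

text \<open>
  The points \<open>\<alpha>(0), \<dots>, \<alpha>(n)\<close> with \<open>n = CARD('n)\<close> are given by a map on \<open>nat\<close>, of which only the
  values at arguments \<open>\<le> CARD('n)\<close> matter. The coordinate vector below is extended by \<open>0\<close> beyond
  \<open>CARD('n)\<close> so as to be unique; it is only used for affinely independent points and for \<open>\<beta>\<close> in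
  their convex hull.
\<close>

definition bary :: "(nat \<Rightarrow> nat ^ 'n::finite) \<Rightarrow> nat ^ 'n \<Rightarrow> nat \<Rightarrow> real" where
  "bary \<alpha> \<beta> = (THE l. (\<forall>j\<le>CARD('n). l j \<ge> 0) \<and> (\<forall>j>CARD('n). l j = 0) \<and>
      (\<Sum>j\<le>CARD('n). l j) = 1 \<and> (\<Sum>j\<le>CARD('n). l j *\<^sub>R rvec (\<alpha> j)) = rvec \<beta>)"

definition nz :: "(nat \<Rightarrow> nat ^ 'n::finite) \<Rightarrow> nat ^ 'n \<Rightarrow> nat set" where
  "nz \<alpha> \<beta> = {j. j \<le> CARD('n) \<and> bary \<alpha> \<beta> j \<noteq> 0}"

definition ST_standard_form :: "(nat \<Rightarrow> nat ^ 'n::finite) \<Rightarrow> 'n rpoly \<Rightarrow> bool" where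
  "ST_standard_form \<alpha> f \<longleftrightarrow>
     f = (\<Sum>j\<le>CARD('n). Poly_Mapping.single (\<alpha> j) (mcoeff f (\<alpha> j)))
         + (\<Sum>\<beta>\<in>Delta f. Poly_Mapping.single \<beta> (mcoeff f \<beta>)) \<and>
     \<alpha> 0 = 0 \<and> inj_on \<alpha> {..CARD('n)} \<and> \<not> affine_dependent (rvec ` \<alpha> ` {..CARD('n)}) \<and>
     (\<forall>j\<le>CARD('n). even_vec (\<alpha> j)) \<and>
     rvec ` Delta f \<subseteq> convex hull (rvec ` \<alpha> ` {..CARD('n)}) \<and>
     (\<forall>j\<le>CARD('n). mcoeff f (\<alpha> j) \<ge> 0 \<and>
        (mcoeff f (\<alpha> j) = 0 \<longrightarrow> (\<forall>\<beta>\<in>Delta f. bary \<alpha> \<beta> j = 0)))"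

definition circuit_poly :: "'n::finite rpoly \<Rightarrow> bool" where
  "circuit_poly g \<longleftrightarrow> (\<exists>\<alpha>. ST_standard_form \<alpha> g) \<and> (Delta g = {} \<or> (\<exists>\<beta>. Delta g = {\<beta>}))"


section \<open>The global infimum and its lower bounds\<close>

definition f_inf :: "'n::finite rpoly \<Rightarrow> ereal" where
  "f_inf f = (INF x. ereal (poly_eval f x))"

definition f_sos :: "'n::finite rpoly \<Rightarrow> ereal" where
  "f_sos f = (SUP r \<in> {r. \<exists>gs. f - const_poly r = sum_list (map (\<lambda>g. g ^ 2) gs)}. ereal r)"

text \<open>
  The two descriptions of the geometric programming bound \<open>f\<^sub>g\<^sub>p\<close>: by sums of nonnegative circuit
  polynomials, and by the optimization problem over the \<open>a\<^bsub>\<beta>,j\<^esub>\<close>. The real exponents are rendered by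
  \<^const>\<open>powr\<close>; all bases occurring at feasible points are positive.
\<close>

definition gp_circuit :: "'n::finite rpoly \<Rightarrow> ereal" where
  "gp_circuit f = (SUP r \<in> {r. \<exists>gs. f - const_poly r = sum_list gs \<and>
      (\<forall>g\<in>set gs. circuit_poly g \<and> nonneg_poly g \<and>
         newton g face_of convex hull ({0} \<union> newton_vertices f))}. ereal r)"

definition gp_feasible ::
  "(nat \<Rightarrow> nat ^ 'n::finite) \<Rightarrow> 'n rpoly \<Rightarrow> (nat ^ 'n \<Rightarrow> nat \<Rightarrow> real) \<Rightarrow> real \<Rightarrow> bool" where
  "gp_feasible \<alpha> f a r \<longleftrightarrow>
     (\<forall>\<beta>\<in>Delta f. \<forall>j\<in>{1..CARD('n)}. a \<beta> j \<ge> 0 \<and> (bary \<alpha> \<beta> j > 0 \<longrightarrow> a \<beta> j > 0)) \<and>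
     (\<forall>\<beta>\<in>Delta f. bary \<alpha> \<beta> 0 = 0 \<longrightarrow>
        \<bar>mcoeff f \<beta>\<bar> \<le> (\<Prod>j\<in>{j\<in>nz \<alpha> \<beta>. j \<ge> 1}. (a \<beta> j / bary \<alpha> \<beta> j) powr bary \<alpha> \<beta> j)) \<and>
     (\<forall>j\<in>{1..CARD('n)}. mcoeff f (\<alpha> j) \<ge> (\<Sum>\<beta>\<in>Delta f. a \<beta> j)) \<and>
     mcoeff f 0 - r \<ge> (\<Sum>\<beta>\<in>{\<beta>\<in>Delta f. 0 \<in> nz \<alpha> \<beta>}.
        bary \<alpha> \<beta> 0 * \<bar>mcoeff f \<beta>\<bar> powr (1 / bary \<alpha> \<beta> 0) *
        (\<Prod>j\<in>{j\<in>nz \<alpha> \<beta>. j \<ge> 1}.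
           (bary \<alpha> \<beta> j / a \<beta> j) powr (bary \<alpha> \<beta> j / bary \<alpha> \<beta> 0)))"

definition gp_program :: "(nat \<Rightarrow> nat ^ 'n::finite) \<Rightarrow> 'n rpoly \<Rightarrow> ereal" where
  "gp_program \<alpha> f = (SUP r \<in> {r. \<exists>a. gp_feasible \<alpha> f a r}. ereal r)"


section \<open>Mediated sets\<close>

definition int_points :: "(real ^ 'n::finite) set" where
  "int_points = {x. \<forall>i. x $ i \<in> \<int>}"

definition even_points :: "(real ^ 'n::finite) set" where
  "even_points = {x. \<forall>i. \<exists>k::int. x $ i = 2 * of_int k}"

definition even_midpoints :: "(real ^ 'n::finite) set \<Rightarrow> (real ^ 'n) set" where
  "even_midpoints L = {(1/2) *\<^sub>R (s + t) | s t.
     s \<in> L \<inter> even_points \<and> t \<in> L \<inter> even_points \<and> s \<noteq> t}"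

primrec med_iter :: "(real ^ 'n::finite) set \<Rightarrow> nat \<Rightarrow> (real ^ 'n) set" where
  "med_iter P 0 = (convex hull P) \<inter> int_points"
| "med_iter P (Suc k) = even_midpoints (med_iter P k) \<union> P"

text \<open>The stationary value of the sequence; it exists when \<open>P\<close> is a finite set of even points.\<close>

definition med_star :: "(real ^ 'n::finite) set \<Rightarrow> (real ^ 'n) set" where
  "med_star P = (THE S. \<exists>K. \<forall>k\<ge>K. med_iter P k = S)"

end

theory Submission
  imports Defs
begin

text \<open>
  Suppose \<open>Delta f\<close> is nonempty. As its members are interior to the Newton polytope, all \<open>n + 1\<close> vertex
  coefficients are positive, and the Newton polytope is the simplex spanned by the \<open>\<alpha>(j)\<close>. In the orthant
  of \<open>v\<close> the substitution \<open>x\<^sub>i = sgn v\<^sub>i * exp y\<^sub>i\<close> transforms \<open>f\<close> into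
  \<open>f\<^sub>0 + (\<Sum>j\<ge>1. f\<^sub>\<alpha>\<^sub>(\<^sub>j\<^sub>) exp (\<alpha>(j) \<bullet> y)) - (\<Sum>\<beta>\<in>Delta f. |f\<^sub>\<beta>| exp (\<beta> \<bullet> y))\<close>, where only the exponents in
  \<open>Delta f\<close> contribute negatively. This function has a minimum and hence a critical point
  (\<open>signomial_critical_point\<close>, \<open>critical_point_exists\<close>).

  Let \<open>x\<close> be the corresponding point and \<open>w\<^sub>\<beta> = - f\<^sub>\<beta> x^\<beta> > 0\<close>. Expanded in the basis
  \<open>\<alpha>(1), \<dots>, \<alpha>(n)\<close>, the vanishing of the gradient is the polynomial identity (\<open>certificate\<close>)
  \<open>f(z) - f(x) = (\<Sum>\<beta>\<in>Delta f. w\<^sub>\<beta> G\<^sub>\<beta>(z))\<close> with the agiforms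
  \<open>G\<^sub>\<beta>(z) = (\<Sum>j. \<lambda>\<^sub>j\<^sup>(\<^sup>\<beta>\<^sup>) (z/x)^\<alpha>(j)) - (z/x)^\<beta>\<close>. By the weighted inequality of arithmetic and geometric
  means they are nonnegative, so \<open>f(x)\<close> is the global minimum. Each \<open>w\<^sub>\<beta> G\<^sub>\<beta>\<close> is a nonnegative circuit
  polynomial on the whole simplex, and its coefficients form an optimal point of the geometric program
  (\<open>gp_circuit_eq\<close>, \<open>gp_program_eq\<close>); the same inequality at \<open>x\<close> shows that no feasible value exceeds \<open>f(x)\<close>.

  If \<open>Delta f\<close> lies in the mediated set, then every \<open>G\<^sub>\<beta>\<close> is a sum of squares: for a midpoint
  \<open>\<beta> = (2s + 2t) / 2\<close> one has \<open>G\<^sub>\<beta> = (G\<^sub>2\<^sub>s + G\<^sub>2\<^sub>t) / 2 + ((z/x)^s - (z/x)^t)\<^sup>2 / 2\<close>, and these relations form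
  a linear system whose elimination only ever adds nonnegative multiples of squares
  (\<open>substochastic_system_in_cone\<close>, \<open>agiform_sos\<close>).

  If \<open>Delta f\<close> is empty, then \<open>f\<close> is a sum of monomial squares with minimum \<open>f(0)\<close>
  (\<open>bounds_without_Delta\<close>).
\<close>

section \<open>Evaluating polynomials\<close>

text \<open>
  Evaluation at a point is the case \<open>h = mono_eval x\<close>; another choice of \<open>h\<close> serves below as a linear
  functional that is positive on certain squares.
\<close>

definition coeff_sum :: "(nat ^ 'n::finite \<Rightarrow> real) \<Rightarrow> 'n rpoly \<Rightarrow> real" where
  "coeff_sum h p = (\<Sum>\<gamma>\<in>Poly_Mapping.keys p. mcoeff p \<gamma> * h \<gamma>)"

lemma poly_eval_coeff_sum: "poly_eval p x = coeff_sum (mono_eval x) p"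
  by (simp add: poly_eval_def coeff_sum_def)

lemma coeff_sum_superset:
  assumes "finite A" "Poly_Mapping.keys p \<subseteq> A"
  shows "coeff_sum h p = (\<Sum>\<gamma>\<in>A. mcoeff p \<gamma> * h \<gamma>)"
  unfolding coeff_sum_def
  using assms by (intro sum.mono_neutral_left) (auto simp: in_keys_iff)

lemma coeff_sum_single [simp]: "coeff_sum h (Poly_Mapping.single \<gamma> c) = c * h \<gamma>"
  by (simp add: coeff_sum_def)

lemma coeff_sum_zero [simp]: "coeff_sum h 0 = 0"
  by (simp add: coeff_sum_def)

lemma coeff_sum_add: "coeff_sum h (p + q) = coeff_sum h p + coeff_sum h q"
proof -
  let ?A = "Poly_Mapping.keys p \<union> Poly_Mapping.keys q"
  have "coeff_sum h r = (\<Sum>\<gamma>\<in>?A. mcoeff r \<gamma> * h \<gamma>)" if "r \<in> {p, q, p + q}" for r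
    using that keys_add[of p q] by (intro coeff_sum_superset) auto
  then show ?thesis
    by (simp add: lookup_add sum.distrib algebra_simps)
qed

lemma coeff_sum_diff: "coeff_sum h (p - q) = coeff_sum h p - coeff_sum h q"
  using coeff_sum_add[of h "p - q" q] by simp

lemma coeff_sum_sum: "coeff_sum h (sum p A) = (\<Sum>i\<in>A. coeff_sum h (p i))"
  by (induction A rule: infinite_finite_induct) (auto simp: coeff_sum_add)

lemma coeff_sum_sum_list: "coeff_sum h (sum_list ps) = (\<Sum>p\<leftarrow>ps. coeff_sum h p)"
  by (induction ps) (auto simp: coeff_sum_add)

lemma poly_as_sum_of_monomials:
  "(p :: 'n::finite rpoly) = (\<Sum>\<gamma>\<in>Poly_Mapping.keys p. Poly_Mapping.single \<gamma> (mcoeff p \<gamma>))"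
proof (rule poly_mapping_eqI)
  fix k
  have "(\<Sum>\<gamma>\<in>Poly_Mapping.keys p. mcoeff (Poly_Mapping.single \<gamma> (mcoeff p \<gamma>)) k) =
        (\<Sum>\<gamma>\<in>Poly_Mapping.keys p. if \<gamma> = k then mcoeff p \<gamma> else 0)"
    by (intro sum.cong) (auto simp: lookup_single)
  then show "mcoeff p k =
    mcoeff (\<Sum>\<gamma>\<in>Poly_Mapping.keys p. Poly_Mapping.single \<gamma> (mcoeff p \<gamma>)) k"
    by (auto simp: lookup_sum in_keys_iff)
qed

lemma mono_eval_add: "mono_eval x (\<beta> + \<gamma>) = mono_eval x \<beta> * mono_eval x \<gamma>"
  by (simp add: mono_eval_def power_add prod.distrib)

lemma mono_eval_0 [simp]: "mono_eval x 0 = 1"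
  by (simp add: mono_eval_def)

lemma mono_eval_nonzero: "(\<And>i. x $ i \<noteq> 0) \<Longrightarrow> mono_eval x \<beta> \<noteq> 0"
  by (simp add: mono_eval_def)

lemma mono_eval_even_nonneg: "even_vec \<beta> \<Longrightarrow> mono_eval x \<beta> \<ge> 0"
  by (auto simp: mono_eval_def even_vec_def zero_le_even_power intro!: prod_nonneg)

lemma coeff_sum_mult:
  assumes "\<And>\<beta> \<gamma>. h (\<beta> + \<gamma>) = h \<beta> * h \<gamma>"
  shows "coeff_sum h (p * q) = coeff_sum h p * coeff_sum h q"
proof -
  let ?s = "\<lambda>p \<gamma>. Poly_Mapping.single \<gamma> (mcoeff p \<gamma>)"
  have "p * q = (\<Sum>\<beta>\<in>Poly_Mapping.keys p. ?s p \<beta>) * (\<Sum>\<gamma>\<in>Poly_Mapping.keys q. ?s q \<gamma>)"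
    using poly_as_sum_of_monomials[of p] poly_as_sum_of_monomials[of q] by simp
  also have "\<dots> = (\<Sum>\<beta>\<in>Poly_Mapping.keys p. \<Sum>\<gamma>\<in>Poly_Mapping.keys q. ?s p \<beta> * ?s q \<gamma>)"
    by (rule sum_product)
  finally have "coeff_sum h (p * q) = (\<Sum>\<beta>\<in>Poly_Mapping.keys p. \<Sum>\<gamma>\<in>Poly_Mapping.keys q.
      (mcoeff p \<beta> * h \<beta>) * (mcoeff q \<gamma> * h \<gamma>))"
    by (simp add: coeff_sum_sum mult_single assms mult_ac)
  then show ?thesis
    by (simp add: coeff_sum_def sum_product)
qed

lemma poly_eval_diff: "poly_eval (p - q) x = poly_eval p x - poly_eval q x"
  by (simp add: poly_eval_coeff_sum coeff_sum_diff)

lemma poly_eval_sum_list: "poly_eval (sum_list ps) x = (\<Sum>p\<leftarrow>ps. poly_eval p x)"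
  by (simp add: poly_eval_coeff_sum coeff_sum_sum_list)

lemma poly_eval_const [simp]: "poly_eval (const_poly r) x = r"
  by (simp add: poly_eval_coeff_sum)

lemma poly_eval_power2: "poly_eval (p ^ 2) x = (poly_eval p x) ^ 2"
  by (simp add: poly_eval_coeff_sum power2_eq_square coeff_sum_mult mono_eval_add)

lemma coeff_sum_const_mult: "coeff_sum h (const_poly c * p) = c * coeff_sum h p"
proof -
  have "const_poly c * p =
      (\<Sum>\<gamma>\<in>Poly_Mapping.keys p. Poly_Mapping.single \<gamma> (c * mcoeff p \<gamma>))"
    by (subst (1) poly_as_sum_of_monomials[of p]) (simp add: sum_distrib_left mult_single)
  then have "coeff_sum h (const_poly c * p) = (\<Sum>\<gamma>\<in>Poly_Mapping.keys p. c * mcoeff p \<gamma> * h \<gamma>)"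
    by (simp add: coeff_sum_sum)
  then show ?thesis
    by (simp add: coeff_sum_def sum_distrib_left mult_ac)
qed

lemma vector_space_const_mult: "vector_space (\<lambda>c (p :: 'n::finite rpoly). const_poly c * p)"
  by unfold_locales
     (simp_all add: algebra_simps single_add mult_single flip: mult.assoc)

section \<open>The weighted inequality of arithmetic and geometric means\<close>

text \<open>
  Jensen's inequality for the exponential function, once the case of a vanishing factor is set aside.
\<close>

lemma weighted_am_gm:
  fixes w u :: "'a \<Rightarrow> real"
  assumes "finite J" "\<And>j. j \<in> J \<Longrightarrow> w j > 0" "sum w J = 1" "\<And>j. j \<in> J \<Longrightarrow> u j \<ge> 0"
  shows "(\<Prod>j\<in>J. u j powr w j) \<le> (\<Sum>j\<in>J. w j * u j)"
proof (cases "\<exists>j\<in>J. u j = 0")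
  case True
  then have "(\<Prod>j\<in>J. u j powr w j) = 0"
    using assms(1) by (intro prod_zero) auto
  moreover have "(\<Sum>j\<in>J. w j * u j) \<ge> 0"
    using assms by (intro sum_nonneg) (auto simp: less_imp_le)
  ultimately show ?thesis by simp
next
  case False
  then have pos: "u j > 0" if "j \<in> J" for j
    using assms(4) that by (force simp: less_le)
  have "J \<noteq> {}" using assms(3) by auto
  have "(\<Prod>j\<in>J. u j powr w j) = exp (\<Sum>j\<in>J. w j * ln (u j))"
    using pos by (simp add: exp_sum[OF assms(1)] powr_def less_imp_neq[THEN not_sym] cong: prod.cong)
  also have "\<dots> \<le> (\<Sum>j\<in>J. w j * exp (ln (u j)))"
    using convex_on_sum[OF assms(1) \<open>J \<noteq> {}\<close> exp_convex assms(3), of "\<lambda>j. ln (u j)"] assms(2)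
    by (simp add: less_imp_le)
  also have "\<dots> = (\<Sum>j\<in>J. w j * u j)"
    using pos by simp
  finally show ?thesis .
qed

section \<open>Eliminating unknowns from a substochastic system\<close>

text \<open>
  If every unknown \<open>G b\<close> is a substochastic combination of all unknowns plus an element of a convex cone
  \<open>K\<close> that omits \<open>0\<close>, then every \<open>G b\<close> lies in \<open>K\<close>. Formally iterating the system gives a Neumann series
  with terms in \<open>K\<close>; Gaussian elimination has the same signs and only finite sums, which stay in \<open>K\<close>.
  The pivot \<open>1 - P z z\<close> cannot vanish: otherwise row \<open>z\<close> would be concentrated on the diagonal and
  would force the inhomogeneity, an element of \<open>K\<close>, to be \<open>0\<close>. Eliminating \<open>G z\<close> from the other rows
  leaves them nonnegative with row sums at most \<open>1\<close>.
\<close>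

lemma substochastic_system_in_cone:
  fixes scale :: "real \<Rightarrow> 'v::ab_group_add \<Rightarrow> 'v"
  assumes "vector_space scale"
    and cone_add: "\<And>x y. x \<in> K \<Longrightarrow> y \<in> K \<Longrightarrow> x + y \<in> K"
    and cone_scale: "\<And>c x. c > 0 \<Longrightarrow> x \<in> K \<Longrightarrow> scale c x \<in> K"
    and zero: "0 \<notin> K"
    and "finite S"
    and nonneg: "\<And>b c. b \<in> S \<Longrightarrow> c \<in> S \<Longrightarrow> P b c \<ge> 0"
    and rows: "\<And>b. b \<in> S \<Longrightarrow> (\<Sum>c\<in>S. P b c) \<le> 1"
    and sys: "\<And>b. b \<in> S \<Longrightarrow> G b - (\<Sum>c\<in>S. scale (P b c) (G c)) \<in> K"
    and "b \<in> S"
  shows "G b \<in> K"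
  using \<open>finite S\<close> nonneg rows sys \<open>b \<in> S\<close>
proof (induction S arbitrary: P b rule: finite_induct)
  case empty
  then show ?case by simp
next
  interpret vector_space scale by fact
  case (insert z S)
  define q where "q = 1 - P z z"
  define C where "C b = G b - (\<Sum>c\<in>insert z S. scale (P b c) (G c))" for b
  have C: "C b \<in> K" if "b \<in> insert z S" for b
    using insert.prems(3) that by (simp add: C_def)
  have row_z: "(\<Sum>c\<in>S. P z c) \<le> q"
    using insert.prems(2)[of z] insert.hyps by (simp add: q_def)
  have G_z: "scale q (G z) = (\<Sum>c\<in>S. scale (P z c) (G c)) + C z"
    using insert.hyps by (simp add: C_def q_def algebra_simps)
  have nonneg: "P b c \<ge> 0" if "b \<in> insert z S" "c \<in> insert z S" for b c
    using insert.prems(1) that by blast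
  have "q > 0"
  proof (rule ccontr)
    assume "\<not> q > 0"
    then have sum0: "(\<Sum>c\<in>S. P z c) = 0"
      using row_z sum_nonneg[of S "P z"] nonneg by force
    then have "q = 0"
      using row_z \<open>\<not> q > 0\<close> by simp
    have "P z c = 0" if "c \<in> S" for c
      using sum0 insert.hyps(1) nonneg that by (subst (asm) sum_nonneg_eq_0_iff) auto
    then have "C z = 0"
      using G_z \<open>q = 0\<close> by simp
    then show False
      using C zero by force
  qed
  have G_z': "G z = (\<Sum>c\<in>S. scale (P z c / q) (G c)) + scale (1 / q) (C z)"
  proof -
    have "G z = scale (1 / q) (scale q (G z))"
      using \<open>q > 0\<close> by simp
    then show ?thesis
      unfolding G_z by (simp add: scale_right_distrib scale_sum_right)
  qed
  have step: "x + scale c (C z) \<in> K" if "x \<in> K" "c \<ge> 0" for x c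
    using cone_add[OF that(1) cone_scale[of c "C z"]] that C by (cases "c = 0") auto
  have G_S: "G b \<in> K" if "b \<in> S" for b
  proof (rule insert.IH[where P = "\<lambda>b c. P b c + P b z * (P z c / q)"])
    fix b c assume "b \<in> S" "c \<in> S"
    then show "P b c + P b z * (P z c / q) \<ge> 0"
      using nonneg \<open>q > 0\<close> by simp
  next
    fix b assume b: "b \<in> S"
    have "(\<Sum>c\<in>S. P b c + P b z * (P z c / q)) = (\<Sum>c\<in>S. P b c) + P b z * ((\<Sum>c\<in>S. P z c) / q)"
      by (simp add: sum.distrib sum_distrib_left sum_divide_distrib)
    also have "\<dots> \<le> (\<Sum>c\<in>S. P b c) + P b z * 1"
      using row_z \<open>q > 0\<close> nonneg b by (intro add_left_mono mult_left_mono) auto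
    also have "\<dots> \<le> 1"
      using insert.prems(2)[of b] b insert.hyps by simp
    finally show "(\<Sum>c\<in>S. P b c + P b z * (P z c / q)) \<le> 1" .
  next
    fix b assume b: "b \<in> S"
    have "G b - (\<Sum>c\<in>S. scale (P b c + P b z * (P z c / q)) (G c)) =
        G b - (\<Sum>c\<in>S. scale (P b c) (G c)) -
        scale (P b z) (\<Sum>c\<in>S. scale (P z c / q) (G c))"
      by (simp add: scale_left_distrib sum.distrib scale_sum_right)
    also have "(\<Sum>c\<in>S. scale (P z c / q) (G c)) = G z - scale (1 / q) (C z)"
      by (subst G_z') simp
    also have "G b - (\<Sum>c\<in>S. scale (P b c) (G c)) - scale (P b z) (G z - scale (1 / q) (C z)) =
        C b + scale (P b z / q) (C z)"
      using insert.hyps by (simp add: C_def scale_right_diff_distrib)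
    also have "\<dots> \<in> K"
      using step[of "C b" "P b z / q"] C nonneg b \<open>q > 0\<close> by simp
    finally show "G b - (\<Sum>c\<in>S. scale (P b c + P b z * (P z c / q)) (G c)) \<in> K" .
  qed (use that in auto)
  have "(\<Sum>c\<in>T. scale (P z c / q) (G c)) + scale (1 / q) (C z) \<in> K" if "T \<subseteq> S" for T
    using finite_subset[OF that insert.hyps(1)] that
  proof (induction T rule: finite_induct)
    case empty
    then show ?case using cone_scale C \<open>q > 0\<close> by simp
  next
    case (insert c T)
    have "P z c / q \<ge> 0" using nonneg insert.prems \<open>q > 0\<close> by simp
    then have "scale (P z c / q) (G c) \<in> K \<or> scale (P z c / q) (G c) = 0"
      using cone_scale[of "P z c / q" "G c"] G_S[of c] insert.prems by (cases "P z c / q = 0") auto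
    then show ?case
      using insert cone_add by (auto simp: add.assoc)
  qed
  then have "G z \<in> K"
    using G_z' by simp
  then show ?case
    using G_S insert.prems(4) by auto
qed

section \<open>Barycentric coordinates in a simplex with vertex 0\<close>

text \<open>
  The vectors \<open>a 1, \<dots>, a n\<close> form a basis with dual basis \<open>d 1, \<dots>, d n\<close>. Together with \<open>a 0 = 0\<close> they
  span a simplex, and the dual basis makes its barycentric coordinates explicit affine functions.
\<close>

locale dual_bases =
  fixes a d :: "nat \<Rightarrow> real ^ 'n::finite"
  assumes a0: "a 0 = 0"
    and dual: "\<And>i j. i \<in> {1..CARD('n)} \<Longrightarrow> j \<in> {1..CARD('n)} \<Longrightarrow> a i \<bullet> d j = (if i = j then 1 else 0)"
    and expand: "\<And>x. (\<Sum>j=1..CARD('n). (x \<bullet> d j) *\<^sub>R a j) = x"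

lemma dual_bases_exist:
  fixes a :: "nat \<Rightarrow> real ^ 'n::finite"
  assumes a0: "a 0 = 0" and inj: "inj_on a {..CARD('n)}"
    and indep: "\<not> affine_dependent (a ` {..CARD('n)})"
  shows "\<exists>d. dual_bases a d"
proof -
  let ?I = "{1..CARD('n)}"
  let ?S = "a ` ?I"
  have split: "{..CARD('n)} = insert 0 ?I" by auto
  have inj_I: "inj_on a ?I" using inj by (rule inj_on_subset) auto
  have "0 \<notin> ?S"
  proof
    assume "0 \<in> ?S"
    then obtain j where "j \<in> ?I" "a j = a 0" using a0 by auto
    then show False using inj by (auto simp: inj_on_eq_iff)
  qed
  have "a ` {..CARD('n)} = insert 0 ?S" using a0 by (simp add: split)
  then have ind: "independent ?S"
    using indep affine_dependent_iff_dependent[OF \<open>0 \<notin> ?S\<close>] by simp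
  have "\<exists>d. \<forall>i\<in>?I. a i \<bullet> d = (if i = j then 1 else 0)" if j: "j \<in> ?I" for j
  proof -
    obtain g :: "real ^ 'n \<Rightarrow> real" where g: "linear g" "\<forall>x\<in>?S. g x = (if x = a j then 1 else 0)"
      using linear_independent_extend[OF ind, of "\<lambda>x. if x = a j then 1 else 0"] by blast
    have "a i \<bullet> adjoint g 1 = (if i = j then 1 else 0)" if i: "i \<in> ?I" for i
    proof -
      have "a i \<bullet> adjoint g 1 = g (a i)"
        by (subst adjoint_works[OF g(1)]) simp
      also have "\<dots> = (if a i = a j then 1 else 0)"
        using g(2) i by blast
      also have "\<dots> = (if i = j then 1 else 0)"
        using inj_on_eq_iff[OF inj_I i j] by simp
      finally show ?thesis .
    qed
    then show ?thesis by blast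
  qed
  then obtain d where d: "\<And>j i. j \<in> ?I \<Longrightarrow> i \<in> ?I \<Longrightarrow> a i \<bullet> d j = (if i = j then 1 else 0)"
    by metis
  have "(\<Sum>j\<in>?I. (x \<bullet> d j) *\<^sub>R a j) = x" for x
  proof -
    have "span ?S = UNIV"
      using card_ge_dim_independent[of ?S UNIV] ind inj_I by (auto simp: card_image)
    then obtain u where "x = (\<Sum>v\<in>?S. u v *\<^sub>R v)"
      using span_finite[of ?S] by auto
    then have x: "x = (\<Sum>i\<in>?I. u (a i) *\<^sub>R a i)"
      using inj_I by (simp add: sum.reindex)
    have "x \<bullet> d j = u (a j)" if "j \<in> ?I" for j
    proof -
      have "x \<bullet> d j = (\<Sum>i\<in>?I. u (a i) * (a i \<bullet> d j))"
        by (subst x) (simp add: inner_sum_left)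
      also have "\<dots> = (\<Sum>i\<in>?I. if i = j then u (a i) else 0)"
        using d that by (intro sum.cong) auto
      finally show ?thesis using that by simp
    qed
    then show ?thesis using x by simp
  qed
  then have "dual_bases a d"
    using a0 d by unfold_locales auto
  then show ?thesis by blast
qed

context dual_bases
begin

lemma inner_expand: "x \<bullet> y = (\<Sum>j\<in>{1..CARD('n)}. (x \<bullet> d j) * (a j \<bullet> y))"
  by (subst expand[of x, symmetric]) (simp add: inner_sum_left)

lemma expand_dual: "(\<Sum>j\<in>{1..CARD('n)}. (a j \<bullet> y) *\<^sub>R d j) = y"
proof -
  let ?z = "\<Sum>j\<in>{1..CARD('n)}. (a j \<bullet> y) *\<^sub>R d j"
  have "a i \<bullet> ?z = a i \<bullet> y" if "i \<in> {1..CARD('n)}" for i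
  proof -
    have "a i \<bullet> ?z = (\<Sum>j\<in>{1..CARD('n)}. if j = i then a j \<bullet> y else 0)"
      unfolding inner_sum_right using that dual by (intro sum.cong) auto
    then show ?thesis using that by simp
  qed
  then have "x \<bullet> ?z = x \<bullet> y" for x
    by (subst (1 2) inner_expand) simp
  then show ?thesis
    using vector_eq_ldot by blast
qed

lemma norm_le_of_inner_bounded:
  assumes "\<And>j. j \<in> {1..CARD('n)} \<Longrightarrow> \<bar>a j \<bullet> y\<bar> \<le> R"
  shows "norm y \<le> R * (\<Sum>j\<in>{1..CARD('n)}. norm (d j))"
proof -
  have "norm y = norm (\<Sum>j\<in>{1..CARD('n)}. (a j \<bullet> y) *\<^sub>R d j)"
    by (subst expand_dual) (rule refl)
  also have "\<dots> \<le> (\<Sum>j\<in>{1..CARD('n)}. norm ((a j \<bullet> y) *\<^sub>R d j))"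
    by (rule norm_sum)
  also have "\<dots> \<le> (\<Sum>j\<in>{1..CARD('n)}. R * norm (d j))"
    using assms by (intro sum_mono) (auto intro!: mult_right_mono)
  finally show ?thesis
    by (simp add: sum_distrib_left)
qed

text \<open>
  The function
  \<open>F y = (\<Sum>j. A j * exp (a j \<bullet> y)) - (\<Sum>\<beta>. c \<beta> * exp (b \<beta> \<bullet> y))\<close>
  attains its minimum; the equations are its derivatives in the directions \<open>d j\<close>. In terms of the
  independent positive quantities \<open>t\<^sub>j = exp (a j \<bullet> y)\<close> the negative terms are the monomials
  \<open>\<Prod>j. t\<^sub>j powr (b \<beta> \<bullet> d j)\<close> of total degree less than \<open>1\<close> in which every \<open>t\<^sub>j\<close> occurs. Low degree makes
  them negligible for large \<open>t\<close> and dominant near \<open>0\<close> on the diagonal, so that negative values occur; as they vanish when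
  a single \<open>t\<^sub>j\<close> tends to \<open>0\<close> with the others bounded, a sublevel set of \<open>F\<close> below a negative level is
  bounded.
\<close>

lemma signomial_critical_point:
  fixes D :: "'b set" and A :: "nat \<Rightarrow> real" and c :: "'b \<Rightarrow> real" and b :: "'b \<Rightarrow> real ^ 'n"
  assumes D: "finite D" "D \<noteq> {}"
    and A: "\<And>j. j \<in> {1..CARD('n)} \<Longrightarrow> A j > 0"
    and c: "\<And>\<beta>. \<beta> \<in> D \<Longrightarrow> c \<beta> > 0"
    and l: "\<And>\<beta> j. \<beta> \<in> D \<Longrightarrow> j \<in> {1..CARD('n)} \<Longrightarrow> b \<beta> \<bullet> d j > 0"
    and l0: "\<And>\<beta>. \<beta> \<in> D \<Longrightarrow> (\<Sum>j\<in>{1..CARD('n)}. b \<beta> \<bullet> d j) < 1"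
  shows "\<exists>y. \<forall>j\<in>{1..CARD('n)}. A j * exp (a j \<bullet> y) = (\<Sum>\<beta>\<in>D. c \<beta> * (b \<beta> \<bullet> d j) * exp (b \<beta> \<bullet> y))"
proof -
  define F where "F y = (\<Sum>j\<in>{1..CARD('n)}. A j * exp (a j \<bullet> y)) - (\<Sum>\<beta>\<in>D. c \<beta> * exp (b \<beta> \<bullet> y))" for y
  define \<mu> where "\<mu> \<beta> = 1 - (\<Sum>j\<in>{1..CARD('n)}. b \<beta> \<bullet> d j)" for \<beta>
  have \<mu>: "\<mu> \<beta> > 0" if "\<beta> \<in> D" for \<beta> using l0[OF that] by (simp add: \<mu>_def)
  have l1: "b \<beta> \<bullet> d j \<le> 1" if "\<beta> \<in> D" "j \<in> {1..CARD('n)}" for \<beta> j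
  proof -
    have "b \<beta> \<bullet> d j \<le> (\<Sum>j\<in>{1..CARD('n)}. b \<beta> \<bullet> d j)"
      using that l by (intro member_le_sum) (auto simp: less_imp_le)
    then show ?thesis using l0[OF that(1)] by simp
  qed

  \<comment> \<open>Along \<open>y = - s *\<^sub>R (\<Sum>j. d j)\<close> all \<open>exp (a j \<bullet> y)\<close> equal \<open>exp (- s)\<close>; the chosen \<open>s\<close> makes one
      negative term outweigh the sum of the positive ones.\<close>
  obtain y0 where y0: "F y0 < 0"
  proof -
    obtain \<beta>0 where \<beta>0: "\<beta>0 \<in> D" using D(2) by blast
    define s where "s = ln ((sum A {1..CARD('n)} + 1) / c \<beta>0) / \<mu> \<beta>0"
    define y where "y = - s *\<^sub>R (\<Sum>j\<in>{1..CARD('n)}. d j)"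
    have A0: "sum A {1..CARD('n)} + 1 > 0"
      using A by (intro add_nonneg_pos sum_nonneg) (auto simp: less_imp_le)
    have ay: "a j \<bullet> y = - s" if "j \<in> {1..CARD('n)}" for j
    proof -
      have "a j \<bullet> (\<Sum>i\<in>{1..CARD('n)}. d i) = (\<Sum>i\<in>{1..CARD('n)}. if i = j then 1 else 0)"
        unfolding inner_sum_right using dual that by (intro sum.cong) auto
      then show ?thesis using that by (simp add: y_def)
    qed
    have b_y: "b \<beta> \<bullet> y = - s + s * \<mu> \<beta>" for \<beta>
      by (simp add: y_def \<mu>_def inner_sum_right algebra_simps)
    have "c \<beta>0 * exp (s * \<mu> \<beta>0) = sum A {1..CARD('n)} + 1"
      using \<mu>[OF \<beta>0] c[OF \<beta>0] A0 by (simp add: s_def)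
    moreover have "c \<beta>0 * exp (s * \<mu> \<beta>0) \<le> (\<Sum>\<beta>\<in>D. c \<beta> * exp (s * \<mu> \<beta>))"
      using D c \<beta>0 by (intro member_le_sum) (auto simp: less_imp_le)
    moreover have "F y = (\<Sum>j\<in>{1..CARD('n)}. A j * exp (- s)) - (\<Sum>\<beta>\<in>D. c \<beta> * (exp (- s) * exp (s * \<mu> \<beta>)))"
      using ay by (simp add: F_def b_y flip: exp_add)
    then have "F y = exp (- s) * (sum A {1..CARD('n)} - (\<Sum>\<beta>\<in>D. c \<beta> * exp (s * \<mu> \<beta>)))"
      by (simp add: sum_distrib_left right_diff_distrib mult_ac)
    ultimately have "F y < 0"
      by (simp add: mult_less_0_iff)
    then show ?thesis using that by blast
  qed

  \<comment> \<open>Upper bound for \<open>a j \<bullet> y\<close>: the weighted mean inequality with an additional argument \<open>exp k\<close> of weight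
      \<open>\<mu> \<beta>\<close> bounds each negative term by a linear function of the \<open>exp (a j \<bullet> y)\<close>, and for large \<open>k\<close> the
      total slope is at most half of the positive one.\<close>
  obtain B where B: "B \<ge> 0" "\<And>y j. F y \<le> 0 \<Longrightarrow> j \<in> {1..CARD('n)} \<Longrightarrow> a j \<bullet> y \<le> B"
  proof -
    have "((\<lambda>k. \<Sum>\<beta>\<in>D. c \<beta> * exp (- \<mu> \<beta> * k) * (b \<beta> \<bullet> d j)) \<longlongrightarrow> (\<Sum>\<beta>\<in>D. c \<beta> * 0 * (b \<beta> \<bullet> d j))) at_top" for j
    proof (intro tendsto_intros)
      fix \<beta> assume "\<beta> \<in> D"
      then have "filterlim (\<lambda>k. - \<mu> \<beta> * k) at_bot at_top"
        using \<mu> by (intro filterlim_tendsto_neg_mult_at_bot[OF tendsto_const _ filterlim_ident]) auto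
      then show "((\<lambda>k. exp (- \<mu> \<beta> * k)) \<longlongrightarrow> 0) at_top"
        by (rule filterlim_compose[OF exp_at_bot])
    qed
    then have "eventually (\<lambda>k. (\<Sum>\<beta>\<in>D. c \<beta> * exp (- \<mu> \<beta> * k) * (b \<beta> \<bullet> d j)) < A j / 2) at_top"
      if "j \<in> {1..CARD('n)}" for j
      using A[OF that] by (intro order_tendstoD(2)) auto
    then have "eventually (\<lambda>k. \<forall>j\<in>{1..CARD('n)}. (\<Sum>\<beta>\<in>D. c \<beta> * exp (- \<mu> \<beta> * k) * (b \<beta> \<bullet> d j)) < A j / 2) at_top"
      by (intro eventually_ball_finite) auto
    then obtain k where k: "\<And>j. j \<in> {1..CARD('n)} \<Longrightarrow>
        (\<Sum>\<beta>\<in>D. c \<beta> * exp (- \<mu> \<beta> * k) * (b \<beta> \<bullet> d j)) < A j / 2"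
      unfolding eventually_at_top_linorder by blast
    define C where "C = (\<Sum>\<beta>\<in>D. c \<beta> * exp (- \<mu> \<beta> * k) * (\<mu> \<beta> * exp k))"
    have amgm: "exp (b \<beta> \<bullet> y) \<le> exp (- \<mu> \<beta> * k) * ((\<Sum>j\<in>{1..CARD('n)}. (b \<beta> \<bullet> d j) * exp (a j \<bullet> y)) + \<mu> \<beta> * exp k)"
      if "\<beta> \<in> D" for \<beta> y
    proof -
      define w where "w j = (if j = 0 then \<mu> \<beta> else b \<beta> \<bullet> d j)" for j :: nat
      define u where "u j = (if j = 0 then k else a j \<bullet> y)" for j :: nat
      have "(\<Prod>j\<in>insert 0 {1..CARD('n)}. exp (u j) powr w j) \<le> (\<Sum>j\<in>insert 0 {1..CARD('n)}. w j * exp (u j))"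
        using \<mu>[OF that] l[OF that] by (intro weighted_am_gm) (auto simp: w_def \<mu>_def)
      also have "(\<Prod>j\<in>insert 0 {1..CARD('n)}. exp (u j) powr w j) = exp (\<mu> \<beta> * k + b \<beta> \<bullet> y)"
        by (subst inner_expand[of "b \<beta>"]) (simp add: exp_add exp_sum powr_def w_def u_def)
      also have "(\<Sum>j\<in>insert 0 {1..CARD('n)}. w j * exp (u j)) =
          (\<Sum>j\<in>{1..CARD('n)}. (b \<beta> \<bullet> d j) * exp (a j \<bullet> y)) + \<mu> \<beta> * exp k"
        by (simp add: w_def u_def)
      finally show ?thesis
        by (simp add: exp_add exp_minus field_simps)
    qed
    have lower: "(\<Sum>j\<in>{1..CARD('n)}. A j / 2 * exp (a j \<bullet> y)) - C \<le> F y" for y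
    proof -
      have "(\<Sum>\<beta>\<in>D. c \<beta> * exp (b \<beta> \<bullet> y)) \<le>
          (\<Sum>\<beta>\<in>D. c \<beta> * (exp (- \<mu> \<beta> * k) * ((\<Sum>j\<in>{1..CARD('n)}. (b \<beta> \<bullet> d j) * exp (a j \<bullet> y)) + \<mu> \<beta> * exp k)))"
        using amgm c by (intro sum_mono mult_left_mono) (auto simp: less_imp_le)
      also have "\<dots> = (\<Sum>\<beta>\<in>D. \<Sum>j\<in>{1..CARD('n)}. c \<beta> * exp (- \<mu> \<beta> * k) * (b \<beta> \<bullet> d j) * exp (a j \<bullet> y)) + C"
        by (simp add: C_def algebra_simps sum.distrib sum_distrib_left)
      also have "(\<Sum>\<beta>\<in>D. \<Sum>j\<in>{1..CARD('n)}. c \<beta> * exp (- \<mu> \<beta> * k) * (b \<beta> \<bullet> d j) * exp (a j \<bullet> y)) =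
          (\<Sum>j\<in>{1..CARD('n)}. (\<Sum>\<beta>\<in>D. c \<beta> * exp (- \<mu> \<beta> * k) * (b \<beta> \<bullet> d j)) * exp (a j \<bullet> y))"
        by (subst sum.swap) (simp add: sum_distrib_right)
      also have "\<dots> \<le> (\<Sum>j\<in>{1..CARD('n)}. A j / 2 * exp (a j \<bullet> y))"
        using k by (intro sum_mono mult_right_mono) (auto simp: less_imp_le)
      finally show ?thesis
        by (simp add: F_def flip: sum_divide_distrib)
    qed
    have C: "C > 0"
      using \<mu> c D unfolding C_def by (intro sum_pos) auto
    have bound: "a j \<bullet> y \<le> (\<Sum>j\<in>{1..CARD('n)}. \<bar>ln (2 * C / A j)\<bar>)" if "F y \<le> 0" "j \<in> {1..CARD('n)}" for y j
    proof -
      have "A j / 2 * exp (a j \<bullet> y) \<le> (\<Sum>j\<in>{1..CARD('n)}. A j / 2 * exp (a j \<bullet> y))"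
        using that A by (intro member_le_sum) (auto simp: less_imp_le)
      also have "\<dots> \<le> C" using lower[of y] that by simp
      finally have "exp (a j \<bullet> y) \<le> 2 * C / A j"
        using A[OF that(2)] by (simp add: field_simps)
      then have "a j \<bullet> y \<le> ln (2 * C / A j)"
        using C A[OF that(2)] by (subst ln_ge_iff) auto
      also have "\<dots> \<le> \<bar>ln (2 * C / A j)\<bar>" by simp
      also have "\<dots> \<le> (\<Sum>j\<in>{1..CARD('n)}. \<bar>ln (2 * C / A j)\<bar>)"
        using that by (intro member_le_sum) auto
      finally show ?thesis .
    qed
    show ?thesis
      by (rule that[OF _ bound]) (simp_all add: sum_nonneg)
  qed

  \<comment> \<open>Lower bound for \<open>a j \<bullet> y\<close>: if one of these is very negative while all are at most \<open>B\<close>, every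
      negative term is too small for the value \<open>F y0\<close>.\<close>
  obtain N where N: "\<And>y j. F y \<le> F y0 \<Longrightarrow> j \<in> {1..CARD('n)} \<Longrightarrow> - N \<le> a j \<bullet> y"
  proof -
    have "((\<lambda>N. \<Sum>\<beta>\<in>D. c \<beta> * exp (- (b \<beta> \<bullet> d j) * N) * exp B) \<longlongrightarrow> (\<Sum>\<beta>\<in>D. c \<beta> * 0 * exp B)) at_top"
      if "j \<in> {1..CARD('n)}" for j
    proof (intro tendsto_intros)
      fix \<beta> assume "\<beta> \<in> D"
      then have "filterlim (\<lambda>N. - (b \<beta> \<bullet> d j) * N) at_bot at_top"
        using l that by (intro filterlim_tendsto_neg_mult_at_bot[OF tendsto_const _ filterlim_ident]) auto
      then show "((\<lambda>N. exp (- (b \<beta> \<bullet> d j) * N)) \<longlongrightarrow> 0) at_top"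
        by (rule filterlim_compose[OF exp_at_bot])
    qed
    then have "eventually (\<lambda>N. (\<Sum>\<beta>\<in>D. c \<beta> * exp (- (b \<beta> \<bullet> d j) * N) * exp B) < - F y0) at_top"
      if "j \<in> {1..CARD('n)}" for j
      using that y0 by (intro order_tendstoD(2)) auto
    then have "eventually (\<lambda>N. \<forall>j\<in>{1..CARD('n)}. (\<Sum>\<beta>\<in>D. c \<beta> * exp (- (b \<beta> \<bullet> d j) * N) * exp B) < - F y0) at_top"
      by (intro eventually_ball_finite) auto
    then obtain N where N: "\<And>j. j \<in> {1..CARD('n)} \<Longrightarrow> (\<Sum>\<beta>\<in>D. c \<beta> * exp (- (b \<beta> \<bullet> d j) * N) * exp B) < - F y0"
      unfolding eventually_at_top_linorder by blast
    have "- N \<le> a j \<bullet> y" if y: "F y \<le> F y0" and j: "j \<in> {1..CARD('n)}" for y j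
    proof (rule ccontr)
      assume "\<not> - N \<le> a j \<bullet> y"
      then have small: "a j \<bullet> y \<le> - N" by simp
      have exponent: "b \<beta> \<bullet> y \<le> - (b \<beta> \<bullet> d j) * N + B" if "\<beta> \<in> D" for \<beta>
      proof -
        have "b \<beta> \<bullet> y = (b \<beta> \<bullet> d j) * (a j \<bullet> y) + (\<Sum>i\<in>{1..CARD('n)} - {j}. (b \<beta> \<bullet> d i) * (a i \<bullet> y))"
          using j by (subst inner_expand) (rule sum.remove, auto)
        also have "(\<Sum>i\<in>{1..CARD('n)} - {j}. (b \<beta> \<bullet> d i) * (a i \<bullet> y)) \<le> (\<Sum>i\<in>{1..CARD('n)} - {j}. (b \<beta> \<bullet> d i) * B)"
          using l[OF that] B(2)[of y] y y0 by (intro sum_mono mult_left_mono) (auto simp: less_imp_le)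
        also have "\<dots> \<le> (\<Sum>i\<in>{1..CARD('n)}. (b \<beta> \<bullet> d i) * B)"
          using l[OF that] B(1) by (intro sum_mono2) (auto simp: less_imp_le)
        also have "\<dots> = (\<Sum>i\<in>{1..CARD('n)}. b \<beta> \<bullet> d i) * B"
          by (simp add: sum_distrib_right)
        also have "\<dots> \<le> 1 * B"
          using l0[OF that] B(1) by (intro mult_right_mono) auto
        also have "(b \<beta> \<bullet> d j) * (a j \<bullet> y) \<le> (b \<beta> \<bullet> d j) * (- N)"
          using l[OF that j] small by (intro mult_left_mono) auto
        finally show ?thesis by simp
      qed
      have "- F y0 \<le> - F y" using y by simp
      also have "\<dots> \<le> (\<Sum>\<beta>\<in>D. c \<beta> * exp (b \<beta> \<bullet> y))"
        using A by (auto simp: F_def less_imp_le intro!: sum_nonneg)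
      also have "\<dots> \<le> (\<Sum>\<beta>\<in>D. c \<beta> * exp (- (b \<beta> \<bullet> d j) * N + B))"
        using exponent c by (intro sum_mono mult_left_mono) (auto simp: less_imp_le)
      also have "\<dots> < - F y0"
        using N[OF j] unfolding exp_add by (simp add: mult.assoc)
      finally show False by simp
    qed
    then show ?thesis using that by blast
  qed

  define R where "R = max B N * (\<Sum>j\<in>{1..CARD('n)}. norm (d j))"
  have sublevel: "y \<in> cball 0 R" if y: "F y \<le> F y0" for y
  proof -
    have "\<bar>a j \<bullet> y\<bar> \<le> max B N" if j: "j \<in> {1..CARD('n)}" for j
      using B(2)[OF _ j, of y] N[OF y j] y y0 by linarith
    then have "norm y \<le> R"
      unfolding R_def by (rule norm_le_of_inner_bounded)
    then show ?thesis by simp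
  qed
  have "continuous_on (cball 0 R) F"
    unfolding F_def by (intro continuous_intros)
  moreover have "cball (0 :: real ^ 'n) R \<noteq> {}" using sublevel[OF order_refl] by blast
  ultimately have "\<exists>y\<in>cball 0 R. \<forall>z\<in>cball 0 R. F y \<le> F z"
    by (intro continuous_attains_inf compact_cball)
  then obtain y where y: "\<forall>z\<in>cball 0 R. F y \<le> F z" ..
  have min: "F y \<le> F z" for z
  proof (cases "F z \<le> F y0")
    case True
    then show ?thesis using y sublevel[OF True] by blast
  next
    case False
    moreover have "F y \<le> F y0" using y sublevel[OF order_refl] by blast
    ultimately show ?thesis by linarith
  qed
  have "A j * exp (a j \<bullet> y) = (\<Sum>\<beta>\<in>D. c \<beta> * (b \<beta> \<bullet> d j) * exp (b \<beta> \<bullet> y))" if j: "j \<in> {1..CARD('n)}" for j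
  proof -
    define F' where "F' = (\<Sum>i\<in>{1..CARD('n)}. A i * (exp (a i \<bullet> y) * (a i \<bullet> d j))) -
        (\<Sum>\<beta>\<in>D. c \<beta> * (exp (b \<beta> \<bullet> y) * (b \<beta> \<bullet> d j)))"
    have "((\<lambda>s. F (y + s *\<^sub>R d j)) has_real_derivative F') (at 0)"
      unfolding F_def F'_def by (auto intro!: derivative_eq_intros DERIV_sum simp: inner_add_right mult_ac)
    then have "F' = 0"
      by (rule DERIV_local_min[of _ _ _ 1]) (auto simp: min)
    moreover have "(\<Sum>i\<in>{1..CARD('n)}. A i * (exp (a i \<bullet> y) * (a i \<bullet> d j))) = (\<Sum>i\<in>{1..CARD('n)}. if i = j then A i * exp (a i \<bullet> y) else 0)"
      using dual j by (intro sum.cong) auto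
    ultimately show ?thesis
      using j by (simp add: F'_def mult_ac)
  qed
  then show ?thesis by blast
qed

definition barycoord :: "real ^ 'n \<Rightarrow> nat \<Rightarrow> real" where
  "barycoord x j = (if j = 0 then 1 - (\<Sum>i\<in>{1..CARD('n)}. x \<bullet> d i) else x \<bullet> d j)"

lemma atMost_CARD: "{..CARD('n)} = insert 0 {1..CARD('n)}"
  by auto

lemma sum_barycoord: "(\<Sum>j\<le>CARD('n). barycoord x j) = 1"
  unfolding atMost_CARD by (simp add: barycoord_def)

lemma barycoord_expand: "(\<Sum>j\<le>CARD('n). barycoord x j *\<^sub>R a j) = x"
  unfolding atMost_CARD using expand[of x] by (simp add: barycoord_def a0)

lemma barycoord_unique:
  assumes "(\<Sum>j\<le>CARD('n). l j) = 1" "(\<Sum>j\<le>CARD('n). l j *\<^sub>R a j) = x" "j \<le> CARD('n)"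
  shows "l j = barycoord x j"
proof -
  have x: "x = (\<Sum>i\<in>{1..CARD('n)}. l i *\<^sub>R a i)"
    using assms(2) unfolding atMost_CARD by (simp add: a0)
  have l: "x \<bullet> d j = l j" if "j \<in> {1..CARD('n)}" for j
  proof -
    have "x \<bullet> d j = (\<Sum>i\<in>{1..CARD('n)}. if i = j then l i else 0)"
      unfolding x inner_sum_left using dual that by (intro sum.cong) auto
    then show ?thesis using that by simp
  qed
  show ?thesis
  proof (cases "j = 0")
    case True
    then show ?thesis
      using assms(1) l unfolding atMost_CARD by (simp add: barycoord_def)
  next
    case False
    then show ?thesis using l[of j] assms(3) by (simp add: barycoord_def)
  qed
qed

lemma barycoord_vertex:
  assumes "i \<le> CARD('n)" "j \<le> CARD('n)"
  shows "barycoord (a i) j = (if i = j then 1 else 0)"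
proof -
  have "(\<Sum>k\<le>CARD('n). (if i = k then 1 else 0) *\<^sub>R a k) = (\<Sum>k\<le>CARD('n). if i = k then a k else 0)"
    by (intro sum.cong) auto
  then show ?thesis
    using barycoord_unique[of "\<lambda>j. if i = j then 1 else 0" "a i" j] assms by simp
qed

lemma barycoord_affine:
  assumes "u + v = 1"
  shows "barycoord (u *\<^sub>R x + v *\<^sub>R y) j = u * barycoord x j + v * barycoord y j"
proof (cases "j = 0")
  case True
  have "1 - (u * X + v * Y) = u * (1 - X) + v * (1 - Y)" for X Y
    using assms by (simp add: algebra_simps)
  then show ?thesis
    using True by (simp add: barycoord_def inner_add_left sum.distrib flip: sum_distrib_left)
qed (simp add: barycoord_def inner_add_left)

lemma simplex_eq: "convex hull (a ` {..CARD('n)}) = {x. \<forall>j\<le>CARD('n). barycoord x j \<ge> 0}"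
proof
  have "convex {x. \<forall>j\<le>CARD('n). barycoord x j \<ge> 0}"
    by (auto simp: convex_def barycoord_affine)
  then show "convex hull (a ` {..CARD('n)}) \<subseteq> {x. \<forall>j\<le>CARD('n). barycoord x j \<ge> 0}"
    by (intro hull_minimal) (auto simp: barycoord_vertex)
  show "{x. \<forall>j\<le>CARD('n). barycoord x j \<ge> 0} \<subseteq> convex hull (a ` {..CARD('n)})"
  proof
    fix x assume "x \<in> {x. \<forall>j\<le>CARD('n). barycoord x j \<ge> 0}"
    then have "(\<Sum>j\<le>CARD('n). barycoord x j *\<^sub>R a j) \<in> convex hull (a ` {..CARD('n)})"
      by (intro convex_sum convex_convex_hull sum_barycoord) (auto intro: hull_inc)
    then show "x \<in> convex hull (a ` {..CARD('n)})"
      by (simp only: barycoord_expand)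
  qed
qed

text \<open>
  Moving from \<open>p\<close> to \<open>(1 + t) p - t a\<^sub>j\<close>, away from the vertex \<open>a j\<close>, turns the \<open>j\<close>-th coordinate \<open>\<lambda>\<close> into
  \<open>(1 + t) \<lambda> - t\<close>, which is still nonnegative for small \<open>t > 0\<close>.
\<close>

lemma barycoord_pos_interior:
  assumes S: "\<And>x. x \<in> S \<Longrightarrow> barycoord x j \<ge> 0" and "p \<in> interior S" "j \<le> CARD('n)"
  shows "barycoord p j > 0"
proof -
  obtain e where e: "e > 0" "cball p e \<subseteq> S"
    using assms(2) by (auto simp: mem_interior_cball)
  define t where "t = e / (1 + norm (p - a j))"
  have t: "t > 0"
    using e(1) by (simp add: t_def add_pos_nonneg)
  have "norm (t *\<^sub>R (p - a j)) = t * norm (p - a j)"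
    using t by simp
  also have "\<dots> \<le> t * (1 + norm (p - a j))"
    using t by (intro mult_left_mono) auto
  also have "\<dots> = e"
    using add_pos_nonneg[OF zero_less_one norm_ge_zero[of "p - a j"]] by (simp add: t_def)
  finally have step: "norm (t *\<^sub>R (p - a j)) \<le> e" .
  have "(1 + t) *\<^sub>R p + (- t) *\<^sub>R a j \<in> S"
    using step by (intro subsetD[OF e(2)]) (simp add: dist_norm algebra_simps norm_minus_commute)
  then have "0 \<le> (1 + t) * barycoord p j + (- t) * barycoord (a j) j"
    using S barycoord_affine[of "1 + t" "- t" p "a j" j] by fastforce
  then have "(1 + t) * barycoord p j \<ge> t"
    using barycoord_vertex[of j j] assms(3) by simp
  then have "(1 + t) * barycoord p j > 0" using t by linarith
  then show ?thesis
    using t by (simp add: zero_less_mult_iff)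
qed

end

section \<open>Agiforms on the simplex of even vertices\<close>

lemma rvec_add: "rvec (\<beta> + \<gamma>) = rvec \<beta> + rvec \<gamma>"
  by (simp add: rvec_def vec_eq_iff)

lemma rvec_0 [simp]: "rvec 0 = 0"
  by (simp add: rvec_def vec_eq_iff)

lemma rvec_eq_iff [simp]: "rvec \<beta> = rvec \<gamma> \<longleftrightarrow> \<beta> = \<gamma>"
  by (simp add: rvec_def vec_eq_iff)

lemma mono_eval_divide:
  "mono_eval (\<chi> i. z $ i / x $ i) \<beta> = mono_eval z \<beta> / mono_eval x \<beta>"
  by (simp add: mono_eval_def power_divide prod_dividef)

text \<open>
  The point \<open>x\<close> serves as the unit of the coordinates: all monomials below are divided by their value at \<open>x\<close>,
  so that the identities at a general critical point become those at \<open>(1, \<dots>, 1)\<close>.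
\<close>

locale scaled_simplex = dual_bases "\<lambda>j. rvec (\<alpha> j)" d
  for \<alpha> :: "nat \<Rightarrow> nat ^ 'n::finite" and d +
  fixes x :: "real ^ 'n"
  assumes even_\<alpha>: "\<And>j. j \<le> CARD('n) \<Longrightarrow> even_vec (\<alpha> j)"
    and x_nonzero: "\<And>i. x $ i \<noteq> 0"
begin

lemma mono_eval_x_nonzero [simp]: "mono_eval x \<beta> \<noteq> 0"
  using x_nonzero by (rule mono_eval_nonzero)

lemma mono_eval_x_\<alpha>_pos: "j \<le> CARD('n) \<Longrightarrow> mono_eval x (\<alpha> j) > 0"
  using mono_eval_even_nonneg[OF even_\<alpha>, of j x] by (simp add: less_le)

lemma \<alpha>_inj:
  assumes "i \<le> CARD('n)" "j \<le> CARD('n)" "\<alpha> i = \<alpha> j"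
  shows "i = j"
  using barycoord_vertex[of i j] barycoord_vertex[of j j] assms by (simp split: if_splits)

text \<open>
  This is the relation \<open>\<beta> = \<Sum>j. \<lambda>\<^sub>j \<alpha>(j)\<close> read multiplicatively, separately in every coordinate of \<open>u\<close>.
  The absolute value is harmless because the \<open>\<alpha> j\<close> are even. Where \<open>u\<close> has a zero entry both sides vanish
  or the entry does not occur on either side, since all \<open>\<lambda>\<^sub>j\<close> are positive.
\<close>

lemma abs_mono_eval_eq_prod_powr:
  assumes "\<And>j. j \<le> CARD('n) \<Longrightarrow> barycoord (rvec \<beta>) j > 0"
  shows "\<bar>mono_eval u \<beta>\<bar> = (\<Prod>j\<le>CARD('n). mono_eval u (\<alpha> j) powr barycoord (rvec \<beta>) j)"
proof -
  let ?l = "barycoord (rvec \<beta>)"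
  have entry: "\<bar>u $ i\<bar> ^ (\<beta> $ i) = (\<Prod>j\<le>CARD('n). (\<bar>u $ i\<bar> ^ (\<alpha> j $ i)) powr ?l j)" for i
  proof -
    have "rvec \<beta> $ i = (\<Sum>j\<le>CARD('n). ?l j *\<^sub>R rvec (\<alpha> j)) $ i"
      by (simp only: barycoord_expand)
    then have \<beta>: "real (\<beta> $ i) = (\<Sum>j\<le>CARD('n). ?l j * real (\<alpha> j $ i))"
      by (simp add: rvec_def)
    show ?thesis
    proof (cases "u $ i = 0")
      case False
      then have t: "\<bar>u $ i\<bar> > 0" by simp
      have "(\<Prod>j\<le>CARD('n). (\<bar>u $ i\<bar> ^ (\<alpha> j $ i)) powr ?l j) =
          (\<Prod>j\<le>CARD('n). \<bar>u $ i\<bar> powr (?l j * real (\<alpha> j $ i)))"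
        using t by (simp add: powr_powr mult.commute flip: powr_realpow)
      also have "\<dots> = \<bar>u $ i\<bar> powr real (\<beta> $ i)"
        unfolding \<beta> using t by (simp add: powr_sum)
      finally show ?thesis using t by (simp add: powr_realpow)
    next
      case True
      have nonneg: "?l j * real (\<alpha> j $ i) \<ge> 0" if "j \<le> CARD('n)" for j
        using assms[OF that] by simp
      show ?thesis
      proof (cases "\<beta> $ i = 0")
        case True
        then have "(\<Sum>j\<le>CARD('n). ?l j * real (\<alpha> j $ i)) = 0"
          using \<beta> by simp
        then have "\<forall>j\<in>{..CARD('n)}. ?l j * real (\<alpha> j $ i) = 0"
          using nonneg by (subst (asm) sum_nonneg_eq_0_iff) auto
        then have "\<alpha> j $ i = 0" if "j \<le> CARD('n)" for j
        proof -
          have "?l j * real (\<alpha> j $ i) = 0"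
            using \<open>\<forall>j\<in>{..CARD('n)}. _\<close> that by blast
          then show ?thesis using assms[OF that] by simp
        qed
        then show ?thesis using True by simp
      next
        case False
        then have "(\<Sum>j\<le>CARD('n). ?l j * real (\<alpha> j $ i)) \<noteq> 0"
          using \<beta> by simp
        then have "\<exists>j\<in>{..CARD('n)}. ?l j * real (\<alpha> j $ i) \<noteq> 0"
          by (rule contrapos_np) (simp add: sum.neutral)
        then obtain j where "j \<le> CARD('n)" "\<alpha> j $ i \<noteq> 0" by auto
        then have "(\<Prod>j\<le>CARD('n). (\<bar>u $ i\<bar> ^ (\<alpha> j $ i)) powr ?l j) = 0"
          using True by (intro prod_zero) (auto intro!: bexI[of _ j])
        moreover have "\<bar>u $ i\<bar> ^ (\<beta> $ i) = 0"
          using True False by simp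
        ultimately show ?thesis by (simp only:)
      qed
    qed
  qed
  have "mono_eval u (\<alpha> j) powr ?l j = (\<Prod>i\<in>UNIV. (\<bar>u $ i\<bar> ^ (\<alpha> j $ i)) powr ?l j)"
    if "j \<le> CARD('n)" for j
  proof -
    have "mono_eval u (\<alpha> j) = (\<Prod>i\<in>UNIV. \<bar>u $ i\<bar> ^ (\<alpha> j $ i))"
      using even_\<alpha>[OF that] by (simp add: mono_eval_def even_vec_def power_even_abs)
    then show ?thesis
      by (simp add: prod_powr_distrib)
  qed
  then have "(\<Prod>j\<le>CARD('n). mono_eval u (\<alpha> j) powr ?l j) =
      (\<Prod>i\<in>UNIV. \<Prod>j\<le>CARD('n). (\<bar>u $ i\<bar> ^ (\<alpha> j $ i)) powr ?l j)"
    by (subst prod.swap) simp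
  also have "\<dots> = \<bar>mono_eval u \<beta>\<bar>"
    by (simp add: mono_eval_def abs_prod power_abs flip: entry)
  finally show ?thesis ..
qed

definition rescaled_mono :: "nat ^ 'n \<Rightarrow> 'n rpoly" where
  "rescaled_mono \<gamma> = Poly_Mapping.single \<gamma> (1 / mono_eval x \<gamma>)"

text \<open>
  Reznick's agiform \<open>(\<Sum>j. \<lambda>\<^sub>j z^\<alpha>(j)) - z^\<beta>\<close>, in the variables \<open>z\<^sub>i / x\<^sub>i\<close>.
\<close>

definition agiform :: "nat ^ 'n \<Rightarrow> 'n rpoly" where
  "agiform \<beta> =
     (\<Sum>j\<le>CARD('n). Poly_Mapping.single (\<alpha> j) (barycoord (rvec \<beta>) j / mono_eval x (\<alpha> j))) - rescaled_mono \<beta>"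

lemma rescaled_mono_mult: "rescaled_mono \<beta> * rescaled_mono \<gamma> = rescaled_mono (\<beta> + \<gamma>)"
  by (simp add: rescaled_mono_def mult_single mono_eval_add)

lemma agiform_nonneg:
  assumes "\<And>j. j \<le> CARD('n) \<Longrightarrow> barycoord (rvec \<beta>) j > 0"
  shows "nonneg_poly (agiform \<beta>)"
  unfolding nonneg_poly_def
proof
  fix z
  define u where "u = (\<chi> i. z $ i / x $ i)"
  have u: "mono_eval u \<gamma> = mono_eval z \<gamma> / mono_eval x \<gamma>" for \<gamma>
    by (simp add: u_def mono_eval_divide)
  have "mono_eval u \<beta> \<le> (\<Prod>j\<le>CARD('n). mono_eval u (\<alpha> j) powr barycoord (rvec \<beta>) j)"
    using abs_mono_eval_eq_prod_powr[OF assms, of u] by simp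
  also have "\<dots> \<le> (\<Sum>j\<le>CARD('n). barycoord (rvec \<beta>) j * mono_eval u (\<alpha> j))"
    using assms even_\<alpha> by (intro weighted_am_gm sum_barycoord) (auto intro: mono_eval_even_nonneg)
  also have "\<dots> - mono_eval u \<beta> = poly_eval (agiform \<beta>) z"
    by (simp add: agiform_def rescaled_mono_def poly_eval_coeff_sum coeff_sum_diff coeff_sum_sum u)
  finally show "0 \<le> poly_eval (agiform \<beta>) z"
    by simp
qed

lemma agiform_vertex: "i \<le> CARD('n) \<Longrightarrow> agiform (\<alpha> i) = 0"
proof -
  assume i: "i \<le> CARD('n)"
  have "(\<Sum>j\<le>CARD('n). Poly_Mapping.single (\<alpha> j) (barycoord (rvec (\<alpha> i)) j / mono_eval x (\<alpha> j))) =
        (\<Sum>j\<le>CARD('n). if j = i then rescaled_mono (\<alpha> i) else 0)"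
    using i by (intro sum.cong) (auto simp: barycoord_vertex rescaled_mono_def)
  then show ?thesis using i by (simp add: agiform_def)
qed

lemma const_mult_agiform:
  "const_poly c * agiform \<beta> =
     (\<Sum>j\<le>CARD('n). Poly_Mapping.single (\<alpha> j) (c * barycoord (rvec \<beta>) j / mono_eval x (\<alpha> j))) +
     Poly_Mapping.single \<beta> (- c / mono_eval x \<beta>)"
  by (simp add: agiform_def rescaled_mono_def right_diff_distrib sum_distrib_left mult_single single_uminus)

text \<open>
  Barycentric coordinates are affine, so at a midpoint the vertex terms average exactly; the defect comes
  from \<open>\<beta>\<close> alone and is half of \<open>z^(2s) + z^(2t) - 2 z^(s + t) = (z^s - z^t)\<^sup>2\<close>.
\<close>

lemma agiform_midpoint:
  "agiform (s + t) - (const_poly (1/2) * agiform (s + s) + const_poly (1/2) * agiform (t + t)) =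
   const_poly (1/2) * (rescaled_mono s - rescaled_mono t) ^ 2"
proof -
  have "rvec (s + t) = (1/2) *\<^sub>R rvec (s + s) + (1/2) *\<^sub>R rvec (t + t)"
    by (simp add: rvec_add scaleR_add_right flip: scaleR_add_left)
  then have barycoord: "barycoord (rvec (s + t)) j = (1/2) * barycoord (rvec (s + s)) j + (1/2) * barycoord (rvec (t + t)) j" for j
    by (simp only: barycoord_affine)
  let ?V = "\<lambda>\<beta>. \<Sum>j\<le>CARD('n). Poly_Mapping.single (\<alpha> j) (barycoord (rvec \<beta>) j / mono_eval x (\<alpha> j))"
  have V: "?V (s + t) = const_poly (1/2) * ?V (s + s) + const_poly (1/2) * ?V (t + t)"
    by (simp add: barycoord add_divide_distrib sum_distrib_left mult_single single_add sum.distrib)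
  have half: "const_poly (1/2) * p + const_poly (1/2) * p = p" for p :: "'n rpoly"
    by (simp flip: distrib_right single_add)
  have "const_poly (1/2) * (rescaled_mono s - rescaled_mono t) ^ 2 =
      const_poly (1/2) * rescaled_mono (s + s) + const_poly (1/2) * rescaled_mono (t + t) -
      (const_poly (1/2) * rescaled_mono (s + t) + const_poly (1/2) * rescaled_mono (s + t))"
    unfolding power2_eq_square by (simp add: algebra_simps rescaled_mono_mult)
  then show ?thesis
    unfolding half agiform_def V by (simp add: algebra_simps)
qed

text \<open>
  Sums of squares on which the linear functional \<open>z^\<gamma> \<mapsto> |\<gamma>|\<^sup>2\<close> (for monomials rescaled by \<open>x\<close>) is positive.
  By strict convexity of \<open>|\<gamma>|\<^sup>2\<close> this functional is positive on \<open>(z^s - z^t)\<^sup>2\<close> for \<open>s \<noteq> t\<close>, and its positivity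
  keeps \<open>0\<close> out of the cone.
\<close>

definition sos_cone :: "'n rpoly set" where
  "sos_cone = {p. (\<exists>gs. p = sum_list (map (\<lambda>g. g ^ 2) gs)) \<and>
                  coeff_sum (\<lambda>\<gamma>. mono_eval x \<gamma> * (norm (rvec \<gamma>)) ^ 2) p > 0}"

lemma const_mult_sos:
  assumes "c \<ge> 0"
  shows "const_poly c * sum_list (map (\<lambda>g. g ^ 2) gs) =
         sum_list (map (\<lambda>g. g ^ 2) (map (\<lambda>g. const_poly (sqrt c) * g) gs))"
proof (induction gs)
  case (Cons g gs)
  have sq: "const_poly c = const_poly (sqrt c) * const_poly (sqrt c)"
    using assms by (simp add: mult_single)
  have "const_poly c * g ^ 2 = (const_poly (sqrt c) * const_poly (sqrt c)) * (g * g)"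
    by (subst sq) (simp only: power2_eq_square)
  also have "\<dots> = (const_poly (sqrt c) * g) ^ 2"
    by (simp only: power2_eq_square mult_ac)
  finally have "const_poly c * g ^ 2 = (const_poly (sqrt c) * g) ^ 2" .
  then show ?case using Cons by (simp add: distrib_left)
qed simp

text \<open>
  Reznick's theorem on mediated sets. The midpoint identity expresses the agiform of a non-vertex as the mean
  of two agiforms with exponents in \<open>M\<close>, plus a square of a binomial; agiforms at vertices are \<open>0\<close>. This
  is a substochastic linear system, which is solved by elimination within the cone of sums of squares.
\<close>

lemma agiform_sos:
  assumes "finite M"
    and mediated: "\<And>\<gamma>. \<gamma> \<in> M \<Longrightarrow> \<gamma> \<notin> \<alpha> ` {..CARD('n)} \<Longrightarrow>
       \<exists>s t. s \<noteq> t \<and> \<gamma> = s + t \<and> s + s \<in> M \<and> t + t \<in> M"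
    and "\<beta> \<in> M"
  shows "\<exists>gs. agiform \<beta> = sum_list (map (\<lambda>g. g ^ 2) gs)"
proof (cases "\<beta> \<in> \<alpha> ` {..CARD('n)}")
  case True
  then have "agiform \<beta> = sum_list (map (\<lambda>g. g ^ 2) [])"
    by (auto simp: agiform_vertex)
  then show ?thesis by blast
next
  case False
  define S where "S = M - \<alpha> ` {..CARD('n)}"
  have "\<forall>\<gamma>\<in>S. \<exists>s t. s \<noteq> t \<and> \<gamma> = s + t \<and> s + s \<in> M \<and> t + t \<in> M"
    using mediated by (auto simp: S_def)
  then obtain s t where st: "\<And>\<gamma>. \<gamma> \<in> S \<Longrightarrow>
      s \<gamma> \<noteq> t \<gamma> \<and> \<gamma> = s \<gamma> + t \<gamma> \<and> s \<gamma> + s \<gamma> \<in> M \<and> t \<gamma> + t \<gamma> \<in> M"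
    by metis
  have fin: "finite S" using assms(1) by (simp add: S_def)
  define P where "P \<gamma> c = (if s \<gamma> + s \<gamma> = c then 1/2 else 0) + (if t \<gamma> + t \<gamma> = c then 1/2 else (0::real))" for \<gamma> c
  have "agiform \<beta> \<in> sos_cone"
  proof (rule substochastic_system_in_cone[OF vector_space_const_mult, where P = P and G = agiform and S = S])
    fix p q assume "p \<in> sos_cone" "q \<in> sos_cone"
    then obtain gs hs where "p = sum_list (map (\<lambda>g. g ^ 2) gs)" "q = sum_list (map (\<lambda>g. g ^ 2) hs)"
      by (auto simp: sos_cone_def)
    then have "p + q = sum_list (map (\<lambda>g. g ^ 2) (gs @ hs))" by simp
    then have "\<exists>gs. p + q = sum_list (map (\<lambda>g. g ^ 2) gs)" by blast
    then show "p + q \<in> sos_cone"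
      using \<open>p \<in> sos_cone\<close> \<open>q \<in> sos_cone\<close> by (simp add: sos_cone_def coeff_sum_add)
  next
    fix c :: real and p assume "c > 0" "p \<in> sos_cone"
    then show "const_poly c * p \<in> sos_cone"
      unfolding sos_cone_def
      by (auto simp: coeff_sum_const_mult const_mult_sos[OF less_imp_le] simp del: map_map)
  next
    show "0 \<notin> sos_cone" by (simp add: sos_cone_def)
  next
    fix \<gamma> assume \<gamma>: "\<gamma> \<in> S"
    have one: "(\<Sum>c\<in>S. if b = c then 1/2 else (0::real)) \<le> 1/2" for b
      using fin by simp
    show "(\<Sum>c\<in>S. P \<gamma> c) \<le> 1"
      unfolding P_def sum.distrib
      using one[of "s \<gamma> + s \<gamma>"] one[of "t \<gamma> + t \<gamma>"] by linarith
    have half: "(\<Sum>c\<in>S. const_poly (if b = c then 1/2 else 0) * agiform c) = const_poly (1/2) * agiform b"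
      if "b \<in> M" for b
    proof -
      have "(\<Sum>c\<in>S. const_poly (if b = c then 1/2 else 0) * agiform c) =
            (\<Sum>c\<in>S. if b = c then const_poly (1/2) * agiform c else 0)"
        by (intro sum.cong) auto
      also have "\<dots> = const_poly (1/2) * agiform b"
        using fin that agiform_vertex by (auto simp: S_def)
      finally show ?thesis .
    qed
    have "agiform \<gamma> - (\<Sum>c\<in>S. const_poly (P \<gamma> c) * agiform c) =
       const_poly (1/2) * (rescaled_mono (s \<gamma>) - rescaled_mono (t \<gamma>)) ^ 2"
      using st[OF \<gamma>] agiform_midpoint[of "s \<gamma>" "t \<gamma>"] half
      by (simp add: P_def single_add distrib_right sum.distrib)
    also have "\<dots> \<in> sos_cone"
    proof -
      let ?h = "\<lambda>\<gamma>. mono_eval x \<gamma> * (norm (rvec \<gamma>)) ^ 2"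
      let ?q = "const_poly (1/2) * (rescaled_mono (s \<gamma>) - rescaled_mono (t \<gamma>)) ^ 2"
      have sq: "?q = sum_list (map (\<lambda>g. g ^ 2) [const_poly (sqrt (1/2)) * (rescaled_mono (s \<gamma>) - rescaled_mono (t \<gamma>))])"
        using const_mult_sos[of "1/2" "[rescaled_mono (s \<gamma>) - rescaled_mono (t \<gamma>)]"] by simp
      have double: "coeff_sum ?h (2 * p) = 2 * coeff_sum ?h p" for p
        by (simp only: mult_2 coeff_sum_add)
      have h: "coeff_sum ?h (rescaled_mono \<delta>) = (norm (rvec \<delta>)) ^ 2" for \<delta>
        by (simp add: rescaled_mono_def)
      have "?q = const_poly (1/2) * (rescaled_mono (s \<gamma> + s \<gamma>) + rescaled_mono (t \<gamma> + t \<gamma>) -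
          rescaled_mono (s \<gamma> + t \<gamma>) - rescaled_mono (s \<gamma> + t \<gamma>))"
        unfolding power2_eq_square by (simp add: algebra_simps rescaled_mono_mult)
      then have "coeff_sum ?h ?q = (1/2) * ((norm (rvec (s \<gamma> + s \<gamma>))) ^ 2 + (norm (rvec (t \<gamma> + t \<gamma>))) ^ 2
          - 2 * (norm (rvec (s \<gamma> + t \<gamma>))) ^ 2)"
        by (simp add: coeff_sum_const_mult coeff_sum_add coeff_sum_diff double h)
      also have "\<dots> = (norm (rvec (s \<gamma>) - rvec (t \<gamma>))) ^ 2"
        unfolding rvec_add power2_norm_eq_inner inner_add_left inner_add_right inner_diff_left
          inner_diff_right by (simp add: inner_commute)
      also have "\<dots> > 0"
        using st[OF \<gamma>] by simp
      finally show ?thesis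
        using sq unfolding sos_cone_def by blast
    qed
    finally show "agiform \<gamma> - (\<Sum>c\<in>S. const_poly (P \<gamma> c) * agiform c) \<in> sos_cone" .
  qed (use assms(3) False fin in \<open>auto simp: S_def P_def\<close>)
  then show ?thesis by (auto simp: sos_cone_def)
qed

text \<open>
  Within the simplex, where the coordinates are nonnegative, the description by \<open>THE\<close> picks them out.
\<close>

lemma bary_eq_barycoord:
  assumes "rvec \<beta> \<in> convex hull (rvec ` \<alpha> ` {..CARD('n)})" "j \<le> CARD('n)"
  shows "bary \<alpha> \<beta> j = barycoord (rvec \<beta>) j"
proof -
  define l where "l j = (if j \<le> CARD('n) then barycoord (rvec \<beta>) j else 0)" for j
  have "\<forall>j\<le>CARD('n). barycoord (rvec \<beta>) j \<ge> 0"
    using assms(1) simplex_eq by (auto simp: image_image)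
  then have l: "(\<forall>j\<le>CARD('n). l j \<ge> 0) \<and> (\<forall>j>CARD('n). l j = 0) \<and>
      (\<Sum>j\<le>CARD('n). l j) = 1 \<and> (\<Sum>j\<le>CARD('n). l j *\<^sub>R rvec (\<alpha> j)) = rvec \<beta>"
    using sum_barycoord[of "rvec \<beta>"] barycoord_expand[of "rvec \<beta>"] by (simp add: l_def)
  have "bary \<alpha> \<beta> = l"
    unfolding bary_def
  proof (rule the_equality)
    show "(\<forall>j\<le>CARD('n). l j \<ge> 0) \<and> (\<forall>j>CARD('n). l j = 0) \<and>
      (\<Sum>j\<le>CARD('n). l j) = 1 \<and> (\<Sum>j\<le>CARD('n). l j *\<^sub>R rvec (\<alpha> j)) = rvec \<beta>"
      by (fact l)
  next
    fix l' assume l': "(\<forall>j\<le>CARD('n). l' j \<ge> 0) \<and> (\<forall>j>CARD('n). l' j = 0) \<and>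
      (\<Sum>j\<le>CARD('n). l' j) = 1 \<and> (\<Sum>j\<le>CARD('n). l' j *\<^sub>R rvec (\<alpha> j)) = rvec \<beta>"
    show "l' = l"
    proof
      fix j show "l' j = l j"
        using l' barycoord_unique[of l' "rvec \<beta>" j] by (cases "j \<le> CARD('n)") (auto simp: l_def)
    qed
  qed
  then show ?thesis using assms(2) by (simp add: l_def)
qed


lemma simplex_circuit:
  fixes g :: "'n rpoly"
  assumes g: "g = (\<Sum>j\<le>CARD('n). Poly_Mapping.single (\<alpha> j) (b j)) + Poly_Mapping.single \<beta> e"
    and b: "\<And>j. j \<le> CARD('n) \<Longrightarrow> b j > 0"
    and \<beta>: "\<beta> \<notin> \<alpha> ` {..CARD('n)}" "rvec \<beta> \<in> convex hull (rvec ` \<alpha> ` {..CARD('n)})"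
    and e: "e < 0 \<or> \<not> even_vec \<beta> \<and> e > 0"
    and indep: "\<not> affine_dependent (rvec ` \<alpha> ` {..CARD('n)})"
  shows "circuit_poly g" and "newton g = convex hull (rvec ` \<alpha> ` {..CARD('n)})"
proof -
  have coeff: "mcoeff g \<gamma> = (\<Sum>j\<le>CARD('n). if \<alpha> j = \<gamma> then b j else 0) + (if \<beta> = \<gamma> then e else 0)" for \<gamma>
    by (simp add: g lookup_add lookup_sum lookup_single when_def)
  have other: "mcoeff g \<gamma> = (if \<beta> = \<gamma> then e else 0)" if "\<gamma> \<notin> \<alpha> ` {..CARD('n)}" for \<gamma>
  proof -
    have "(\<Sum>j\<le>CARD('n). if \<alpha> j = \<gamma> then b j else 0) = 0"
      using that by (intro sum.neutral) auto
    then show ?thesis by (simp add: coeff)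
  qed
  have vertex: "mcoeff g (\<alpha> i) = b i" if i: "i \<le> CARD('n)" for i
  proof -
    have "(\<Sum>j\<le>CARD('n). if \<alpha> j = \<alpha> i then b j else 0) = (\<Sum>j\<le>CARD('n). if j = i then b j else 0)"
      using \<alpha>_inj[OF _ i] by (intro sum.cong) auto
    then show ?thesis using i \<beta>(1) by (auto simp: coeff)
  qed
  have Delta: "Delta g = {\<beta>}"
  proof (rule set_eqI)
    fix \<gamma> show "\<gamma> \<in> Delta g \<longleftrightarrow> \<gamma> \<in> {\<beta>}"
    proof (cases "\<gamma> \<in> \<alpha> ` {..CARD('n)}")
      case True
      then obtain i where i: "i \<le> CARD('n)" "\<gamma> = \<alpha> i" by auto
      then show ?thesis
        using vertex[of i] b[of i] even_\<alpha>[of i] \<beta>(1) by (auto simp: Delta_def)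
    next
      case False
      then show ?thesis
        using other[of \<gamma>] e by (auto simp: Delta_def)
    qed
  qed
  have e': "mcoeff g \<beta> = e" using other[OF \<beta>(1)] by simp
  have "ST_standard_form \<alpha> g"
    unfolding ST_standard_form_def Delta
  proof (intro conjI)
    show "g = (\<Sum>j\<le>CARD('n). Poly_Mapping.single (\<alpha> j) (mcoeff g (\<alpha> j))) +
         (\<Sum>\<beta>\<in>{\<beta>}. Poly_Mapping.single \<beta> (mcoeff g \<beta>))"
      unfolding e' by (simp add: vertex e') (simp add: g)
    show "\<alpha> 0 = 0" using a0 rvec_eq_iff[of "\<alpha> 0" 0] by simp
    show "inj_on \<alpha> {..CARD('n)}" using \<alpha>_inj by (auto simp: inj_on_def)
  qed (use even_\<alpha> \<beta> vertex b indep in \<open>force+\<close>)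
  then show "circuit_poly g"
    using Delta by (auto simp: circuit_poly_def)
  have "Poly_Mapping.keys g = insert \<beta> (\<alpha> ` {..CARD('n)})"
  proof (rule set_eqI)
    fix \<gamma> show "\<gamma> \<in> Poly_Mapping.keys g \<longleftrightarrow> \<gamma> \<in> insert \<beta> (\<alpha> ` {..CARD('n)})"
    proof (cases "\<gamma> \<in> \<alpha> ` {..CARD('n)}")
      case True
      then obtain i where i: "i \<le> CARD('n)" "\<gamma> = \<alpha> i" by auto
      then show ?thesis using vertex[of i] b[of i] by (auto simp: in_keys_iff)
    next
      case False
      then show ?thesis using other[of \<gamma>] e by (auto simp: in_keys_iff)
    qed
  qed
  then show "newton g = convex hull (rvec ` \<alpha> ` {..CARD('n)})"
    using \<beta>(2) by (simp add: newton_def hull_redundant)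
qed

end

section \<open>Mediated sets\<close>

lemma finite_bounded_int_points:
  fixes S :: "(real ^ 'n::finite) set"
  assumes "bounded S"
  shows "finite (S \<inter> int_points)"
proof -
  obtain B where B: "\<And>x. x \<in> S \<Longrightarrow> norm x \<le> B"
    using assms by (auto simp: bounded_iff)
  let ?Z = "real_of_int ` {-\<lceil>B\<rceil>..\<lceil>B\<rceil>}"
  have "S \<inter> int_points \<subseteq> vec_lambda ` (PiE UNIV (\<lambda>_ :: 'n. ?Z))"
  proof
    fix x assume x: "x \<in> S \<inter> int_points"
    have "x $ i \<in> ?Z" for i
    proof -
      obtain k :: int where k: "x $ i = of_int k"
        using x by (auto simp: int_points_def elim: Ints_cases)
      have "\<bar>x $ i\<bar> \<le> of_int \<lceil>B\<rceil>"
        using component_le_norm_cart[of x i] B[of x] x le_of_int_ceiling[of B] by (auto intro: order_trans)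
      then have "\<bar>k\<bar> \<le> \<lceil>B\<rceil>"
        unfolding k by linarith
      then show ?thesis using k by (auto simp: abs_le_iff)
    qed
    then show "x \<in> vec_lambda ` (PiE UNIV (\<lambda>_. ?Z))"
      by (intro image_eqI[of _ _ "vec_nth x"]) auto
  qed
  then show ?thesis
    by (rule finite_subset) (auto intro!: finite_imageI finite_PiE)
qed

lemma even_midpoints_mono: "L \<subseteq> L' \<Longrightarrow> even_midpoints L \<subseteq> even_midpoints L'"
  unfolding even_midpoints_def by blast

lemma med_iter_antimono:
  assumes "P \<subseteq> even_points"
  shows "med_iter P (Suc k) \<subseteq> med_iter P k"
proof (induction k)
  case 0
  have "even_midpoints (convex hull P \<inter> int_points) \<subseteq> convex hull P \<inter> int_points"
  proof
    fix x assume "x \<in> even_midpoints (convex hull P \<inter> int_points)"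
    then obtain s t where st: "x = (1/2) *\<^sub>R (s + t)" "s \<in> convex hull P" "t \<in> convex hull P"
        "s \<in> even_points" "t \<in> even_points"
      unfolding even_midpoints_def by blast
    have "(1/2) *\<^sub>R s + (1/2) *\<^sub>R t \<in> convex hull P"
      using st by (intro convexD[OF convex_convex_hull]) auto
    moreover have "x $ i \<in> \<int>" for i
    proof -
      obtain k l :: int where "s $ i = 2 * of_int k" "t $ i = 2 * of_int l"
        using st(4,5) unfolding even_points_def by blast
      then have "x $ i = of_int (k + l)" by (simp add: st(1))
      then show ?thesis by (metis Ints_of_int)
    qed
    ultimately show "x \<in> convex hull P \<inter> int_points"
      by (simp add: st(1) scaleR_add_right int_points_def)
  qed
  moreover have "P \<subseteq> int_points"
  proof
    fix x assume "x \<in> P"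
    then have "x \<in> even_points" using assms by blast
    have "x $ i \<in> \<int>" for i
    proof -
      obtain k :: int where "x $ i = 2 * of_int k"
        using \<open>x \<in> even_points\<close> unfolding even_points_def by blast
      then show ?thesis by simp
    qed
    then show "x \<in> int_points"
      by (simp add: int_points_def)
  qed
  ultimately show ?case
    by (simp add: hull_subset)
next
  case (Suc k)
  then show ?case
    using even_midpoints_mono[of "med_iter P (Suc k)" "med_iter P k"] by auto
qed

text \<open>
  The sets of the sequence are finite, being bounded sets of integer points, and decrease; a member of least
  cardinality is therefore the stationary value, and stationarity is the fixed point equation.
\<close>

lemma med_star_props:
  assumes "finite P" "P \<subseteq> even_points"
  shows "finite (med_star P)" "med_star P \<subseteq> convex hull P"
    "med_star P = even_midpoints (med_star P) \<union> P"
proof -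
  have anti: "med_iter P l \<subseteq> med_iter P k" if "k \<le> l" for k l
    using lift_Suc_antimono_le[of "med_iter P", OF med_iter_antimono[OF assms(2)] that] .
  have "bounded (convex hull P)"
    using assms(1) by (simp add: bounded_convex_hull finite_imp_bounded)
  then have "finite (med_iter P 0)"
    by (simp add: finite_bounded_int_points)
  then have fin: "finite (med_iter P k)" for k
    using anti[of 0 k] finite_subset by blast
  obtain K where K: "\<And>k. card (med_iter P K) \<le> card (med_iter P k)"
    using ex_has_least_nat[of "\<lambda>_. True" 0 "\<lambda>k. card (med_iter P k)"] by blast
  have stat: "med_iter P k = med_iter P K" if "k \<ge> K" for k
    using card_seteq[OF fin anti[OF that] K] .
  have star: "med_star P = med_iter P K"
    unfolding med_star_def
  proof (rule the_equality)
    show "\<exists>L. \<forall>k\<ge>L. med_iter P k = med_iter P K" using stat by blast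
    fix S assume "\<exists>L. \<forall>k\<ge>L. med_iter P k = S"
    then obtain L where "\<forall>k\<ge>L. med_iter P k = S" ..
    then show "S = med_iter P K"
      using stat[of "max K L"] by simp
  qed
  show "finite (med_star P)" using star fin by simp
  show "med_star P \<subseteq> convex hull P" using star anti[of 0 K] by auto
  show "med_star P = even_midpoints (med_star P) \<union> P"
    using stat[of "Suc K"] star by simp
qed

text \<open>
  Mediated sets consist of real vectors; this turns their even points back into
  exponent vectors of monomials.
\<close>

lemma even_point_eq_double:
  assumes "s \<in> even_points" "\<And>i. s $ i \<ge> 0"
  shows "\<exists>\<sigma>. s = rvec (\<sigma> + \<sigma>)"
proof -
  have "\<exists>k::nat. s $ i = 2 * real k" for i
  proof -
    obtain k :: int where "s $ i = 2 * of_int k"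
      using assms(1) unfolding even_points_def by blast
    then show ?thesis
      using assms(2)[of i] by (intro exI[of _ "nat k"]) simp
  qed
  then obtain k where "\<And>i. s $ i = 2 * real (k i)" by metis
  then have "s = rvec ((\<chi> i. k i) + (\<chi> i. k i))"
    by (simp add: rvec_def vec_eq_iff)
  then show ?thesis by blast
qed

lemma (in scaled_simplex) agiform_sos_med_star:
  assumes "rvec \<beta> \<in> med_star (rvec ` \<alpha> ` {..CARD('n)})"
  shows "\<exists>gs. agiform \<beta> = sum_list (map (\<lambda>g. g ^ 2) gs)"
proof -
  let ?V = "rvec ` \<alpha> ` {..CARD('n)}"
  have "?V \<subseteq> even_points"
  proof
    fix p assume "p \<in> ?V"
    then obtain j where j: "j \<le> CARD('n)" "p = rvec (\<alpha> j)" by auto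
    have "\<exists>k::int. p $ i = 2 * of_int k" for i
    proof -
      obtain m where "\<alpha> j $ i = 2 * m"
        using even_\<alpha>[OF j(1)] unfolding even_vec_def by (meson evenE)
      then show ?thesis
        using j by (intro exI[of _ "int m"]) (simp add: rvec_def)
    qed
    then show "p \<in> even_points" by (simp add: even_points_def)
  qed
  note star = med_star_props[of ?V, OF _ this]
  have "convex hull ?V \<subseteq> {p. \<forall>i. p $ i \<ge> 0}"
    by (intro hull_minimal) (auto simp: rvec_def convex_def)
  then have nonneg: "p $ i \<ge> 0" if "p \<in> med_star ?V" for p i
    using star(2) that by auto
  show ?thesis
  proof (rule agiform_sos[where M = "{\<gamma>. rvec \<gamma> \<in> med_star ?V}"])
    have "finite (rvec -` med_star ?V :: (nat ^ 'n) set)"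
      using star(1) by (intro finite_vimageI) (auto simp: inj_on_def)
    then show "finite {\<gamma> :: nat ^ 'n. rvec \<gamma> \<in> med_star ?V}"
      by (simp add: vimage_def)
  next
    fix \<gamma> assume \<gamma>: "\<gamma> \<in> {\<gamma>. rvec \<gamma> \<in> med_star ?V}" "\<gamma> \<notin> \<alpha> ` {..CARD('n)}"
    then have "rvec \<gamma> \<notin> ?V" by auto
    then have "rvec \<gamma> \<in> even_midpoints (med_star ?V)"
      using \<gamma>(1) star(3) by auto
    then obtain s t where st: "rvec \<gamma> = (1/2) *\<^sub>R (s + t)" "s \<in> med_star ?V" "t \<in> med_star ?V"
        "s \<in> even_points" "t \<in> even_points" "s \<noteq> t"
      unfolding even_midpoints_def by blast
    obtain \<sigma> \<tau> where \<sigma>\<tau>: "s = rvec (\<sigma> + \<sigma>)" "t = rvec (\<tau> + \<tau>)"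
      using even_point_eq_double st nonneg by metis
    have "rvec \<gamma> = rvec (\<sigma> + \<tau>)"
      unfolding st(1) \<sigma>\<tau> by (simp add: rvec_add scaleR_add_right flip: scaleR_add_left)
    then show "\<exists>s t. s \<noteq> t \<and> \<gamma> = s + t \<and> s + s \<in> {\<gamma>. rvec \<gamma> \<in> med_star ?V} \<and>
        t + t \<in> {\<gamma>. rvec \<gamma> \<in> med_star ?V}"
      using st \<sigma>\<tau> by (intro exI[of _ \<sigma>] exI[of _ \<tau>]) auto
  qed (use assms in auto)
qed

section \<open>Lower bounds that are attained\<close>

text \<open>
  Each certificate for \<open>f - r\<close> shows \<open>r \<le> f(x)\<close> at every point \<open>x\<close>. A certificate for \<open>f - f(x)\<close> thus
  makes the corresponding supremum equal to \<open>f(x)\<close>.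
\<close>

lemma SUP_ereal_attained:
  assumes "m \<in> S" "\<And>r. r \<in> S \<Longrightarrow> r \<le> m"
  shows "(SUP r\<in>S. ereal r) = ereal m"
  using assms by (intro antisym SUP_least SUP_upper) auto

lemma f_inf_eqI:
  assumes "\<And>z. m \<le> poly_eval f z" "poly_eval f x = m"
  shows "f_inf f = ereal m"
  unfolding f_inf_def using assms
  by (intro antisym INF_greatest) (auto intro!: INF_lower2[of x])

lemma gp_circuit_eqI:
  assumes "f - const_poly (poly_eval f x) = sum_list gs"
    and "\<And>g. g \<in> set gs \<Longrightarrow> circuit_poly g \<and> nonneg_poly g \<and>
         newton g face_of convex hull ({0} \<union> newton_vertices f)"
  shows "gp_circuit f = ereal (poly_eval f x)"
  unfolding gp_circuit_def
proof (rule SUP_ereal_attained)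
  fix r assume "r \<in> {r. \<exists>gs. f - const_poly r = sum_list gs \<and>
      (\<forall>g\<in>set gs. circuit_poly g \<and> nonneg_poly g \<and>
         newton g face_of convex hull ({0} \<union> newton_vertices f))}"
  then obtain gs where gs: "f - const_poly r = sum_list gs" "\<forall>g\<in>set gs. nonneg_poly g"
    by blast
  have "poly_eval f x - r = poly_eval (f - const_poly r) x"
    by (simp add: poly_eval_diff)
  also have "\<dots> \<ge> 0"
    unfolding gs(1) poly_eval_sum_list using gs(2) by (intro sum_list_nonneg) (auto simp: nonneg_poly_def)
  finally show "r \<le> poly_eval f x" by simp
qed (use assms in blast)

lemma f_sos_eqI:
  assumes "f - const_poly (poly_eval f x) = sum_list (map (\<lambda>g. g ^ 2) gs)"
  shows "f_sos f = ereal (poly_eval f x)"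
  unfolding f_sos_def
proof (rule SUP_ereal_attained)
  fix r assume "r \<in> {r. \<exists>gs. f - const_poly r = sum_list (map (\<lambda>g. g ^ 2) gs)}"
  then obtain gs where gs: "f - const_poly r = sum_list (map (\<lambda>g. g ^ 2) gs)"
    by blast
  have "poly_eval f x - r = poly_eval (f - const_poly r) x"
    by (simp add: poly_eval_diff)
  also have "\<dots> \<ge> 0"
    unfolding gs poly_eval_sum_list by (intro sum_list_nonneg) (auto simp: poly_eval_power2)
  finally show "r \<le> poly_eval f x" by simp
qed (use assms in blast)

lemma sum_list_of_sum:
  assumes "finite A"
  obtains gs where "set gs = h ` A" "sum_list gs = sum h A"
proof -
  obtain xs where "set xs = A" "distinct xs"
    using finite_distinct_list[OF assms] by blast
  then show ?thesis
    by (intro that[of "map h xs"]) (auto simp: sum_list_distinct_conv_sum_set)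
qed

lemma sum_of_sos:
  assumes "finite A" "\<And>i. i \<in> A \<Longrightarrow> \<exists>gs. p i = sum_list (map (\<lambda>g. g ^ 2) gs)"
  shows "\<exists>gs. sum p A = sum_list (map (\<lambda>g. g ^ 2) gs)"
  using assms
proof (induction A rule: finite_induct)
  case empty
  then show ?case by (intro exI[of _ "[]"]) simp
next
  case (insert i A)
  then obtain gs hs where "p i = sum_list (map (\<lambda>g. g ^ 2) gs)" "sum p A = sum_list (map (\<lambda>g. g ^ 2) hs)"
    by force
  then have "sum p (insert i A) = sum_list (map (\<lambda>g. g ^ 2) (gs @ hs))"
    using insert.hyps by simp
  then show ?case by blast
qed

lemma single_sum: "Poly_Mapping.single \<gamma> (sum c A) = (\<Sum>i\<in>A. Poly_Mapping.single \<gamma> (c i))"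
  by (induction A rule: infinite_finite_induct) (auto simp: single_add)

lemma finite_Delta: "finite (Delta f)"
  by (rule finite_subset[of _ "Poly_Mapping.keys f"]) (auto simp: Delta_def in_keys_iff)

section \<open>The optimal certificate at a critical point\<close>

text \<open>
  The equations \<open>critical\<close> express that the gradient of \<open>f\<close> vanishes at \<open>x\<close>: multiplying the \<open>i\<close>-th partial
  derivative by \<open>x\<^sub>i\<close> gives the vector equation \<open>(\<Sum>j. f\<^sub>\<alpha>\<^sub>(\<^sub>j\<^sub>) x^\<alpha>(j) *\<^sub>R \<alpha>(j)) + (\<Sum>\<beta>. f\<^sub>\<beta> x^\<beta> *\<^sub>R \<beta>) = 0\<close>,
  whose coordinates in the basis \<open>\<alpha>(1), \<dots>, \<alpha>(n)\<close> are these equations.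
\<close>

locale critical_point_of_ST = scaled_simplex \<alpha> d x
  for \<alpha> :: "nat \<Rightarrow> nat ^ 'n::finite" and d x +
  fixes f :: "'n rpoly"
  assumes ST: "ST_standard_form \<alpha> f"
    and barycoord_pos: "\<And>\<beta> j. \<beta> \<in> Delta f \<Longrightarrow> j \<le> CARD('n) \<Longrightarrow> barycoord (rvec \<beta>) j > 0"
    and Delta_neg: "\<And>\<beta>. \<beta> \<in> Delta f \<Longrightarrow> mcoeff f \<beta> * mono_eval x \<beta> < 0"
    and critical: "\<And>j. j \<in> {1..CARD('n)} \<Longrightarrow> mcoeff f (\<alpha> j) * mono_eval x (\<alpha> j) =
       (\<Sum>\<beta>\<in>Delta f. - (mcoeff f \<beta> * mono_eval x \<beta>) * barycoord (rvec \<beta>) j)"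
begin

definition weight :: "nat ^ 'n \<Rightarrow> real" where
  "weight \<beta> = - (mcoeff f \<beta> * mono_eval x \<beta>)"

lemma weight_pos: "\<beta> \<in> Delta f \<Longrightarrow> weight \<beta> > 0"
  using Delta_neg[of \<beta>] by (simp add: weight_def)

lemma critical_weight:
  "j \<in> {1..CARD('n)} \<Longrightarrow>
     (\<Sum>\<beta>\<in>Delta f. weight \<beta> * barycoord (rvec \<beta>) j) = mcoeff f (\<alpha> j) * mono_eval x (\<alpha> j)"
  by (simp only: weight_def critical)

lemma \<alpha>0: "\<alpha> 0 = 0"
  using ST by (simp add: ST_standard_form_def)

lemma sum_atMost_CARD: "(\<Sum>j\<le>CARD('n). h j) = h 0 + (\<Sum>j\<in>{1..CARD('n)}. h j)"
  unfolding atMost_CARD by simp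

lemma f_repr: "f = (\<Sum>j\<le>CARD('n). Poly_Mapping.single (\<alpha> j) (mcoeff f (\<alpha> j)))
         + (\<Sum>\<beta>\<in>Delta f. Poly_Mapping.single \<beta> (mcoeff f \<beta>))"
  using ST by (simp add: ST_standard_form_def)

lemma poly_eval_x:
  "poly_eval f x = mcoeff f 0 + (\<Sum>j\<in>{1..CARD('n)}. mcoeff f (\<alpha> j) * mono_eval x (\<alpha> j)) - (\<Sum>\<beta>\<in>Delta f. weight \<beta>)"
proof -
  have "poly_eval f x = (\<Sum>j\<le>CARD('n). mcoeff f (\<alpha> j) * mono_eval x (\<alpha> j)) + (\<Sum>\<beta>\<in>Delta f. mcoeff f \<beta> * mono_eval x \<beta>)"
    by (subst f_repr) (simp add: poly_eval_coeff_sum coeff_sum_add coeff_sum_sum)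
  then show ?thesis
    by (simp add: sum_atMost_CARD \<alpha>0 weight_def sum_negf)
qed

lemma critical_value: "poly_eval f x = mcoeff f 0 - (\<Sum>\<beta>\<in>Delta f. weight \<beta> * barycoord (rvec \<beta>) 0)"
proof -
  have "(\<Sum>j\<in>{1..CARD('n)}. mcoeff f (\<alpha> j) * mono_eval x (\<alpha> j)) =
      (\<Sum>j\<in>{1..CARD('n)}. \<Sum>\<beta>\<in>Delta f. weight \<beta> * barycoord (rvec \<beta>) j)"
    by (intro sum.cong refl) (simp only: critical_weight)
  also have "\<dots> = (\<Sum>\<beta>\<in>Delta f. weight \<beta> * (\<Sum>j\<in>{1..CARD('n)}. barycoord (rvec \<beta>) j))"
    by (subst sum.swap) (simp add: sum_distrib_left)
  also have "\<dots> = (\<Sum>\<beta>\<in>Delta f. weight \<beta> * (1 - barycoord (rvec \<beta>) 0))"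
  proof (intro sum.cong refl)
    fix \<beta>
    show "weight \<beta> * (\<Sum>j\<in>{1..CARD('n)}. barycoord (rvec \<beta>) j) = weight \<beta> * (1 - barycoord (rvec \<beta>) 0)"
      using sum_barycoord[of "rvec \<beta>"] unfolding sum_atMost_CARD
      by (metis add_diff_cancel_left')
  qed
  finally show ?thesis
    by (simp add: poly_eval_x algebra_simps sum_subtractf)
qed

text \<open>
  At the exponents in \<open>Delta f\<close> the coefficients agree by the choice of the weights, at
  \<open>\<alpha>(1), \<dots>, \<alpha>(n)\<close> by criticality, and at \<open>\<alpha>(0) = 0\<close> because of the critical value.
\<close>

lemma certificate:
  "f - const_poly (poly_eval f x) = (\<Sum>\<beta>\<in>Delta f. const_poly (weight \<beta>) * agiform \<beta>)"
proof -
  have "(\<Sum>\<beta>\<in>Delta f. const_poly (weight \<beta>) * agiform \<beta>) =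
     (\<Sum>\<beta>\<in>Delta f. \<Sum>j\<le>CARD('n). Poly_Mapping.single (\<alpha> j) (weight \<beta> * barycoord (rvec \<beta>) j / mono_eval x (\<alpha> j))) +
     (\<Sum>\<beta>\<in>Delta f. Poly_Mapping.single \<beta> (- weight \<beta> / mono_eval x \<beta>))"
    by (simp only: const_mult_agiform sum.distrib)
  also have "(\<Sum>\<beta>\<in>Delta f. Poly_Mapping.single \<beta> (- weight \<beta> / mono_eval x \<beta>)) =
      (\<Sum>\<beta>\<in>Delta f. Poly_Mapping.single \<beta> (mcoeff f \<beta>))"
    by (simp add: weight_def)
  also have "(\<Sum>\<beta>\<in>Delta f. \<Sum>j\<le>CARD('n). Poly_Mapping.single (\<alpha> j) (weight \<beta> * barycoord (rvec \<beta>) j / mono_eval x (\<alpha> j))) =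
     (\<Sum>j\<le>CARD('n). Poly_Mapping.single (\<alpha> j) ((\<Sum>\<beta>\<in>Delta f. weight \<beta> * barycoord (rvec \<beta>) j) / mono_eval x (\<alpha> j)))"
    by (subst sum.swap) (simp add: sum_divide_distrib single_sum)
  also have "\<dots> = const_poly (mcoeff f 0 - poly_eval f x) +
     (\<Sum>j\<in>{1..CARD('n)}. Poly_Mapping.single (\<alpha> j) ((\<Sum>\<beta>\<in>Delta f. weight \<beta> * barycoord (rvec \<beta>) j) / mono_eval x (\<alpha> j)))"
    by (simp only: sum_atMost_CARD) (simp add: \<alpha>0 critical_value)
  also have "(\<Sum>j\<in>{1..CARD('n)}. Poly_Mapping.single (\<alpha> j) ((\<Sum>\<beta>\<in>Delta f. weight \<beta> * barycoord (rvec \<beta>) j) / mono_eval x (\<alpha> j))) =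
     (\<Sum>j\<in>{1..CARD('n)}. Poly_Mapping.single (\<alpha> j) (mcoeff f (\<alpha> j)))"
  proof (intro sum.cong refl)
    fix j assume "j \<in> {1..CARD('n)}"
    then show "Poly_Mapping.single (\<alpha> j) ((\<Sum>\<beta>\<in>Delta f. weight \<beta> * barycoord (rvec \<beta>) j) / mono_eval x (\<alpha> j)) =
        Poly_Mapping.single (\<alpha> j) (mcoeff f (\<alpha> j))"
      by (simp only: critical_weight) simp
  qed
  finally show ?thesis
    by (subst f_repr) (simp add: sum_atMost_CARD \<alpha>0 single_diff)
qed

lemma weighted_agiform_nonneg: "\<beta> \<in> Delta f \<Longrightarrow> nonneg_poly (const_poly (weight \<beta>) * agiform \<beta>)"
  using agiform_nonneg[OF barycoord_pos] weight_pos[of \<beta>]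
  by (auto simp: nonneg_poly_def poly_eval_coeff_sum coeff_sum_const_mult)

lemma f_inf_eq: "f_inf f = ereal (poly_eval f x)"
proof (rule f_inf_eqI[where x = x])
  fix z
  have "poly_eval f z - poly_eval f x = poly_eval (f - const_poly (poly_eval f x)) z"
    by (simp add: poly_eval_diff)
  also have "\<dots> = (\<Sum>\<beta>\<in>Delta f. poly_eval (const_poly (weight \<beta>) * agiform \<beta>) z)"
    unfolding certificate by (simp add: poly_eval_coeff_sum coeff_sum_sum)
  also have "\<dots> \<ge> 0"
    using weighted_agiform_nonneg by (intro sum_nonneg) (auto simp: nonneg_poly_def)
  finally show "poly_eval f x \<le> poly_eval f z" by simp
qed simp

lemma gp_circuit_eq:
  assumes vertices: "newton_vertices f = rvec ` \<alpha> ` {..CARD('n)}"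
  shows "gp_circuit f = ereal (poly_eval f x)"
proof -
  let ?h = "\<lambda>\<beta>. const_poly (weight \<beta>) * agiform \<beta>"
  obtain gs where gs: "set gs = ?h ` Delta f" "sum_list gs = sum ?h (Delta f)"
    using sum_list_of_sum[OF finite_Delta] .
  show ?thesis
  proof (rule gp_circuit_eqI)
    show "f - const_poly (poly_eval f x) = sum_list gs"
      by (simp only: certificate gs)
    fix g assume "g \<in> set gs"
    then obtain \<beta> where \<beta>: "\<beta> \<in> Delta f" "g = ?h \<beta>" using gs(1) by blast
    have "rvec \<beta> \<in> convex hull (rvec ` \<alpha> ` {..CARD('n)})"
      using ST \<beta>(1) unfolding ST_standard_form_def by blast
    moreover have "\<beta> \<notin> \<alpha> ` {..CARD('n)}"
      using \<beta>(1) ST even_\<alpha> by (force simp: ST_standard_form_def Delta_def)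
    moreover have "\<not> affine_dependent (rvec ` \<alpha> ` {..CARD('n)})"
      using ST by (simp add: ST_standard_form_def)
    moreover have "- weight \<beta> / mono_eval x \<beta> = mcoeff f \<beta>"
      by (simp add: weight_def)
    moreover have "mcoeff f \<beta> < 0 \<or> \<not> even_vec \<beta> \<and> mcoeff f \<beta> > 0"
      using \<beta>(1) by (simp add: Delta_def)
    ultimately have "circuit_poly g" "newton g = convex hull (rvec ` \<alpha> ` {..CARD('n)})"
      using simplex_circuit[of g "\<lambda>j. weight \<beta> * barycoord (rvec \<beta>) j / mono_eval x (\<alpha> j)" \<beta> "mcoeff f \<beta>"]
        const_mult_agiform[of "weight \<beta>" \<beta>] \<beta> weight_pos barycoord_pos mono_eval_x_\<alpha>_pos by auto
    moreover have "{0} \<union> newton_vertices f = rvec ` \<alpha> ` {..CARD('n)}"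
      unfolding vertices atMost_CARD by (auto simp: \<alpha>0)
    ultimately show "circuit_poly g \<and> nonneg_poly g \<and>
         newton g face_of convex hull ({0} \<union> newton_vertices f)"
      using weighted_agiform_nonneg \<beta> by (simp add: face_of_refl convex_convex_hull)
  qed
qed

lemma f_sos_eq:
  assumes "rvec ` Delta f \<subseteq> med_star (rvec ` \<alpha> ` {..CARD('n)})"
  shows "f_sos f = ereal (poly_eval f x)"
proof -
  have "\<exists>gs. (\<Sum>\<beta>\<in>Delta f. const_poly (weight \<beta>) * agiform \<beta>) = sum_list (map (\<lambda>g. g ^ 2) gs)"
  proof (rule sum_of_sos[OF finite_Delta])
    fix \<beta> assume \<beta>: "\<beta> \<in> Delta f"
    then obtain gs where "agiform \<beta> = sum_list (map (\<lambda>g. g ^ 2) gs)"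
      using agiform_sos_med_star assms by blast
    then show "\<exists>gs. const_poly (weight \<beta>) * agiform \<beta> = sum_list (map (\<lambda>g. g ^ 2) gs)"
      using const_mult_sos[of "weight \<beta>" gs] weight_pos[OF \<beta>] by (metis less_imp_le)
  qed
  then obtain gs where gs: "(\<Sum>\<beta>\<in>Delta f. const_poly (weight \<beta>) * agiform \<beta>) = sum_list (map (\<lambda>g. g ^ 2) gs)" ..
  show ?thesis
    using certificate unfolding gs by (rule f_sos_eqI)
qed

lemma bary_Delta: "\<beta> \<in> Delta f \<Longrightarrow> j \<le> CARD('n) \<Longrightarrow> bary \<alpha> \<beta> j = barycoord (rvec \<beta>) j"
  using ST unfolding ST_standard_form_def by (intro bary_eq_barycoord) blast+

lemma weight_eq_prod:
  assumes "\<beta> \<in> Delta f"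
  shows "weight \<beta> = \<bar>mcoeff f \<beta>\<bar> * (\<Prod>j\<in>{1..CARD('n)}. mono_eval x (\<alpha> j) powr barycoord (rvec \<beta>) j)"
proof -
  have "weight \<beta> = \<bar>mcoeff f \<beta>\<bar> * \<bar>mono_eval x \<beta>\<bar>"
    using Delta_neg[OF assms] by (simp add: weight_def flip: abs_mult)
  also have "\<bar>mono_eval x \<beta>\<bar> = (\<Prod>j\<le>CARD('n). mono_eval x (\<alpha> j) powr barycoord (rvec \<beta>) j)"
    using assms barycoord_pos by (intro abs_mono_eval_eq_prod_powr)
  also have "\<dots> = (\<Prod>j\<in>{1..CARD('n)}. mono_eval x (\<alpha> j) powr barycoord (rvec \<beta>) j)"
    unfolding atMost_CARD by (simp add: \<alpha>0)
  finally show ?thesis .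
qed

text \<open>
  All barycentric coordinates are positive for exponents in the interior, so the case distinctions of the
  program disappear: \<open>nz\<close> is the full index set, and the constraint for \<open>\<lambda>\<^sub>0 = 0\<close> is void.
\<close>

lemma gp_feasible_iff:
  "gp_feasible \<alpha> f a r \<longleftrightarrow>
    (\<forall>\<beta>\<in>Delta f. \<forall>j\<in>{1..CARD('n)}. a \<beta> j > 0) \<and>
    (\<forall>j\<in>{1..CARD('n)}. (\<Sum>\<beta>\<in>Delta f. a \<beta> j) \<le> mcoeff f (\<alpha> j)) \<and>
    (\<Sum>\<beta>\<in>Delta f. barycoord (rvec \<beta>) 0 * \<bar>mcoeff f \<beta>\<bar> powr (1 / barycoord (rvec \<beta>) 0) *
        (\<Prod>j\<in>{1..CARD('n)}. (barycoord (rvec \<beta>) j / a \<beta> j) powr (barycoord (rvec \<beta>) j / barycoord (rvec \<beta>) 0)))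
     \<le> mcoeff f 0 - r"
proof -
  have nz: "nz \<alpha> \<beta> = {..CARD('n)}" if "\<beta> \<in> Delta f" for \<beta>
    using barycoord_pos[OF that] bary_Delta[OF that] by (force simp: nz_def)
  have zero: "{\<beta> \<in> Delta f. 0 \<in> nz \<alpha> \<beta>} = Delta f"
    by (rule Collect_mem_eq[THEN subst]) (auto simp: nz)
  have coords: "{j \<in> nz \<alpha> \<beta>. j \<ge> 1} = {1..CARD('n)}" if "\<beta> \<in> Delta f" for \<beta>
    unfolding nz[OF that] by auto
  have pos: "bary \<alpha> \<beta> j > 0" if "\<beta> \<in> Delta f" "j \<le> CARD('n)" for \<beta> j
    using bary_Delta barycoord_pos that by simp
  have cost: "(\<Sum>\<beta>\<in>Delta f. bary \<alpha> \<beta> 0 * \<bar>mcoeff f \<beta>\<bar> powr (1 / bary \<alpha> \<beta> 0) *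
        (\<Prod>j\<in>{j\<in>nz \<alpha> \<beta>. j \<ge> 1}. (bary \<alpha> \<beta> j / a \<beta> j) powr (bary \<alpha> \<beta> j / bary \<alpha> \<beta> 0))) =
     (\<Sum>\<beta>\<in>Delta f. barycoord (rvec \<beta>) 0 * \<bar>mcoeff f \<beta>\<bar> powr (1 / barycoord (rvec \<beta>) 0) *
        (\<Prod>j\<in>{1..CARD('n)}. (barycoord (rvec \<beta>) j / a \<beta> j) powr (barycoord (rvec \<beta>) j / barycoord (rvec \<beta>) 0)))"
  proof (intro sum.cong refl)
    fix \<beta> assume \<beta>: "\<beta> \<in> Delta f"
    show "bary \<alpha> \<beta> 0 * \<bar>mcoeff f \<beta>\<bar> powr (1 / bary \<alpha> \<beta> 0) *
        (\<Prod>j\<in>{j\<in>nz \<alpha> \<beta>. j \<ge> 1}. (bary \<alpha> \<beta> j / a \<beta> j) powr (bary \<alpha> \<beta> j / bary \<alpha> \<beta> 0)) =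
      barycoord (rvec \<beta>) 0 * \<bar>mcoeff f \<beta>\<bar> powr (1 / barycoord (rvec \<beta>) 0) *
        (\<Prod>j\<in>{1..CARD('n)}. (barycoord (rvec \<beta>) j / a \<beta> j) powr (barycoord (rvec \<beta>) j / barycoord (rvec \<beta>) 0))"
      unfolding coords[OF \<beta>] by (simp add: bary_Delta[OF \<beta>])
  qed
  have sign: "(\<forall>\<beta>\<in>Delta f. \<forall>j\<in>{1..CARD('n)}. a \<beta> j \<ge> 0 \<and> (bary \<alpha> \<beta> j > 0 \<longrightarrow> a \<beta> j > 0)) \<longleftrightarrow>
      (\<forall>\<beta>\<in>Delta f. \<forall>j\<in>{1..CARD('n)}. a \<beta> j > 0)"
  proof (intro ball_cong refl)
    fix \<beta> j assume "\<beta> \<in> Delta f" "j \<in> {1..CARD('n)}"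
    then have "bary \<alpha> \<beta> j > 0" by (intro pos) auto
    then show "a \<beta> j \<ge> 0 \<and> (bary \<alpha> \<beta> j > 0 \<longrightarrow> a \<beta> j > 0) \<longleftrightarrow> a \<beta> j > 0"
      by auto
  qed
  have "\<forall>\<beta>\<in>Delta f. bary \<alpha> \<beta> 0 \<noteq> 0"
    using pos by (metis less_irrefl zero_le)
  then show ?thesis
    unfolding gp_feasible_def zero cost sign by blast
qed

text \<open>
  The numbers \<open>w\<^sub>\<beta> \<lambda>\<^sub>j / x^\<alpha>(j)\<close>, the coefficients of the certificate, are feasible: the constraints at the
  vertices are the critical equations, and the cost of \<open>\<beta>\<close> is its share \<open>w\<^sub>\<beta> \<lambda>\<^sub>0\<close> of \<open>f\<^sub>0 - f(x)\<close>.
  Conversely, for any feasible point the inequality of means bounds the value \<open>w\<^sub>\<beta>\<close> of the negative term at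
  \<open>x\<close> by the cost of \<open>\<beta>\<close> and the value of its shares of the vertex terms; summing over \<open>\<beta>\<close> gives \<open>r \<le> f(x)\<close>.
\<close>

lemma gp_program_eq: "gp_program \<alpha> f = ereal (poly_eval f x)"
  unfolding gp_program_def
proof (rule SUP_ereal_attained)
  define a where "a \<beta> j = weight \<beta> * barycoord (rvec \<beta>) j / mono_eval x (\<alpha> j)" for \<beta> j
  have "(\<Sum>\<beta>\<in>Delta f. a \<beta> j) \<le> mcoeff f (\<alpha> j)" if j: "j \<in> {1..CARD('n)}" for j
  proof -
    have "(\<Sum>\<beta>\<in>Delta f. a \<beta> j) = mcoeff f (\<alpha> j) * mono_eval x (\<alpha> j) / mono_eval x (\<alpha> j)"
      by (simp only: a_def critical_weight[OF j, symmetric] sum_divide_distrib)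
    then show ?thesis by simp
  qed
  moreover have cost: "barycoord (rvec \<beta>) 0 * \<bar>mcoeff f \<beta>\<bar> powr (1 / barycoord (rvec \<beta>) 0) *
        (\<Prod>j\<in>{1..CARD('n)}. (barycoord (rvec \<beta>) j / a \<beta> j) powr (barycoord (rvec \<beta>) j / barycoord (rvec \<beta>) 0)) =
        weight \<beta> * barycoord (rvec \<beta>) 0" if \<beta>: "\<beta> \<in> Delta f" for \<beta>
  proof -
    let ?l = "barycoord (rvec \<beta>)" and ?t = "\<lambda>j. mono_eval x (\<alpha> j)"
    have l: "?l j > 0" if "j \<le> CARD('n)" for j using barycoord_pos[OF \<beta> that] .
    have w: "weight \<beta> > 0" using weight_pos[OF \<beta>] .
    have f: "\<bar>mcoeff f \<beta>\<bar> > 0" using \<beta> by (auto simp: Delta_def)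
    have rest: "(\<Sum>j\<in>{1..CARD('n)}. ?l j) = 1 - ?l 0"
      using sum_barycoord[of "rvec \<beta>"] by (simp add: sum_atMost_CARD)
    have lnw: "ln (weight \<beta>) = ln \<bar>mcoeff f \<beta>\<bar> + (\<Sum>j\<in>{1..CARD('n)}. ?l j * ln (?t j))"
    proof -
      have "(\<Prod>j\<in>{1..CARD('n)}. ?t j powr ?l j) > 0"
        using mono_eval_x_\<alpha>_pos by (intro prod_pos) auto
      then have "ln (weight \<beta>) = ln \<bar>mcoeff f \<beta>\<bar> + ln (\<Prod>j\<in>{1..CARD('n)}. ?t j powr ?l j)"
        unfolding weight_eq_prod[OF \<beta>] using f by (intro ln_mult_pos)
      also have "ln (\<Prod>j\<in>{1..CARD('n)}. ?t j powr ?l j) = (\<Sum>j\<in>{1..CARD('n)}. ?l j * ln (?t j))"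
        using mono_eval_x_\<alpha>_pos by (subst ln_prod) (auto simp: ln_powr)
      finally show ?thesis .
    qed
    have "(\<Prod>j\<in>{1..CARD('n)}. (?l j / a \<beta> j) powr (?l j / ?l 0)) =
        (\<Prod>j\<in>{1..CARD('n)}. exp (?l j / ?l 0 * (ln (?t j) - ln (weight \<beta>))))"
    proof (rule prod.cong)
      fix j assume j: "j \<in> {1..CARD('n)}"
      have "?l j / a \<beta> j = ?t j / weight \<beta>"
        using l[of j] j by (simp add: a_def)
      then show "(?l j / a \<beta> j) powr (?l j / ?l 0) = exp (?l j / ?l 0 * (ln (?t j) - ln (weight \<beta>)))"
        using w mono_eval_x_\<alpha>_pos[of j] j by (simp add: powr_def ln_div)
    qed simp
    also have "\<dots> = exp (\<Sum>j\<in>{1..CARD('n)}. ?l j / ?l 0 * (ln (?t j) - ln (weight \<beta>)))"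
      by (simp add: exp_sum)
    also have "(\<Sum>j\<in>{1..CARD('n)}. ?l j / ?l 0 * (ln (?t j) - ln (weight \<beta>))) =
        ((\<Sum>j\<in>{1..CARD('n)}. ?l j * ln (?t j)) - (\<Sum>j\<in>{1..CARD('n)}. ?l j) * ln (weight \<beta>)) / ?l 0"
      by (simp add: sum_divide_distrib sum_distrib_right sum_subtractf right_diff_distrib diff_divide_distrib)
    also have "\<dots> = ln (weight \<beta>) - ln \<bar>mcoeff f \<beta>\<bar> / ?l 0"
      unfolding rest using lnw l[of 0] by (simp add: field_simps)
    finally have "(\<Prod>j\<in>{1..CARD('n)}. (?l j / a \<beta> j) powr (?l j / ?l 0)) =
        weight \<beta> / \<bar>mcoeff f \<beta>\<bar> powr (1 / ?l 0)"
      using w f by (simp add: exp_diff powr_def)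
    then show ?thesis
      using f by simp
  qed
  moreover have "a \<beta> j > 0" if "\<beta> \<in> Delta f" "j \<in> {1..CARD('n)}" for \<beta> j
    using barycoord_pos weight_pos mono_eval_x_\<alpha>_pos that by (simp add: a_def)
  moreover have "(\<Sum>\<beta>\<in>Delta f. weight \<beta> * barycoord (rvec \<beta>) 0) \<le> mcoeff f 0 - poly_eval f x"
    by (simp add: critical_value)
  ultimately have "gp_feasible \<alpha> f a (poly_eval f x)"
    unfolding gp_feasible_iff by (simp only: cost cong: sum.cong) blast
  then show "poly_eval f x \<in> {r. \<exists>a. gp_feasible \<alpha> f a r}" by blast
next
  fix r assume "r \<in> {r. \<exists>a. gp_feasible \<alpha> f a r}"
  then obtain a where "gp_feasible \<alpha> f a r" by blast
  then have a: "\<And>\<beta> j. \<beta> \<in> Delta f \<Longrightarrow> j \<in> {1..CARD('n)} \<Longrightarrow> a \<beta> j > 0"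
    and budget: "\<And>j. j \<in> {1..CARD('n)} \<Longrightarrow> (\<Sum>\<beta>\<in>Delta f. a \<beta> j) \<le> mcoeff f (\<alpha> j)"
    and cost: "(\<Sum>\<beta>\<in>Delta f. barycoord (rvec \<beta>) 0 * \<bar>mcoeff f \<beta>\<bar> powr (1 / barycoord (rvec \<beta>) 0) *
        (\<Prod>j\<in>{1..CARD('n)}. (barycoord (rvec \<beta>) j / a \<beta> j) powr (barycoord (rvec \<beta>) j / barycoord (rvec \<beta>) 0)))
     \<le> mcoeff f 0 - r"
    unfolding gp_feasible_iff by blast+
  let ?l = "\<lambda>\<beta>. barycoord (rvec \<beta>)" and ?t = "\<lambda>j. mono_eval x (\<alpha> j)"
  define u where "u \<beta> = \<bar>mcoeff f \<beta>\<bar> powr (1 / ?l \<beta> 0) *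
        (\<Prod>j\<in>{1..CARD('n)}. (?l \<beta> j / a \<beta> j) powr (?l \<beta> j / ?l \<beta> 0))" for \<beta>
  have amgm: "weight \<beta> \<le> ?l \<beta> 0 * u \<beta> + (\<Sum>j\<in>{1..CARD('n)}. a \<beta> j * ?t j)" if \<beta>: "\<beta> \<in> Delta f" for \<beta>
  proof -
    have l: "?l \<beta> j > 0" if "j \<le> CARD('n)" for j using barycoord_pos[OF \<beta> that] .
    define w where "w j = (if j = 0 then u \<beta> else a \<beta> j * ?t j / ?l \<beta> j)" for j :: nat
    have u: "u \<beta> \<ge> 0"
      by (auto simp: u_def intro!: prod_nonneg mult_nonneg_nonneg)
    have u_powr: "u \<beta> powr ?l \<beta> 0 = \<bar>mcoeff f \<beta>\<bar> * (\<Prod>j\<in>{1..CARD('n)}. (?l \<beta> j / a \<beta> j) powr ?l \<beta> j)"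
    proof -
      have "(\<Prod>j\<in>{1..CARD('n)}. (?l \<beta> j / a \<beta> j) powr (?l \<beta> j / ?l \<beta> 0)) powr ?l \<beta> 0 =
          (\<Prod>j\<in>{1..CARD('n)}. ((?l \<beta> j / a \<beta> j) powr (?l \<beta> j / ?l \<beta> 0)) powr ?l \<beta> 0)"
        by (rule prod_powr_distrib)
      then show ?thesis
        unfolding u_def using l[of 0] by (simp add: powr_mult prod_nonneg powr_powr)
    qed
    have "weight \<beta> = \<bar>mcoeff f \<beta>\<bar> * (\<Prod>j\<in>{1..CARD('n)}. (?l \<beta> j / a \<beta> j) powr ?l \<beta> j *
        (a \<beta> j * ?t j / ?l \<beta> j) powr ?l \<beta> j)"
    proof -
      have "(?l \<beta> j / a \<beta> j) powr ?l \<beta> j * (a \<beta> j * ?t j / ?l \<beta> j) powr ?l \<beta> j = ?t j powr ?l \<beta> j"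
        if j: "j \<in> {1..CARD('n)}" for j
      proof -
        have "(?l \<beta> j / a \<beta> j) powr ?l \<beta> j * (a \<beta> j * ?t j / ?l \<beta> j) powr ?l \<beta> j =
            ((?l \<beta> j / a \<beta> j) * (a \<beta> j * ?t j / ?l \<beta> j)) powr ?l \<beta> j"
          using l[of j] a[OF \<beta> j] mono_eval_x_\<alpha>_pos[of j] j by (subst powr_mult) auto
        also have "(?l \<beta> j / a \<beta> j) * (a \<beta> j * ?t j / ?l \<beta> j) = ?t j"
          using l[of j] a[OF \<beta> j] j by simp
        finally show ?thesis .
      qed
      then show ?thesis
        by (simp add: weight_eq_prod[OF \<beta>])
    qed
    also have "\<dots> = u \<beta> powr ?l \<beta> 0 * (\<Prod>j\<in>{1..CARD('n)}. (a \<beta> j * ?t j / ?l \<beta> j) powr ?l \<beta> j)"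
      by (simp add: u_powr prod.distrib)
    also have "\<dots> = (\<Prod>j\<le>CARD('n). w j powr ?l \<beta> j)"
      unfolding atMost_CARD by (simp add: w_def)
    also have "\<dots> \<le> (\<Sum>j\<le>CARD('n). ?l \<beta> j * w j)"
      using l a[OF \<beta>] u mono_eval_x_\<alpha>_pos
      by (intro weighted_am_gm sum_barycoord) (auto simp: w_def less_imp_le Suc_le_eq)
    also have "\<dots> = ?l \<beta> 0 * u \<beta> + (\<Sum>j\<in>{1..CARD('n)}. ?l \<beta> j * (a \<beta> j * ?t j / ?l \<beta> j))"
      by (simp add: sum_atMost_CARD w_def)
    also have "(\<Sum>j\<in>{1..CARD('n)}. ?l \<beta> j * (a \<beta> j * ?t j / ?l \<beta> j)) = (\<Sum>j\<in>{1..CARD('n)}. a \<beta> j * ?t j)"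
    proof (intro sum.cong refl)
      fix j assume "j \<in> {1..CARD('n)}"
      then have "?l \<beta> j \<noteq> 0" using l[of j] by simp
      then show "?l \<beta> j * (a \<beta> j * ?t j / ?l \<beta> j) = a \<beta> j * ?t j" by simp
    qed
    finally show ?thesis .
  qed
  have "(\<Sum>\<beta>\<in>Delta f. weight \<beta>) \<le> (\<Sum>\<beta>\<in>Delta f. ?l \<beta> 0 * u \<beta> + (\<Sum>j\<in>{1..CARD('n)}. a \<beta> j * ?t j))"
    using amgm by (rule sum_mono)
  also have "\<dots> = (\<Sum>\<beta>\<in>Delta f. ?l \<beta> 0 * u \<beta>) + (\<Sum>j\<in>{1..CARD('n)}. (\<Sum>\<beta>\<in>Delta f. a \<beta> j) * ?t j)"
    by (simp only: sum.distrib sum_distrib_right) (subst sum.swap, rule refl)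
  also have "(\<Sum>j\<in>{1..CARD('n)}. (\<Sum>\<beta>\<in>Delta f. a \<beta> j) * ?t j) \<le> (\<Sum>j\<in>{1..CARD('n)}. mcoeff f (\<alpha> j) * ?t j)"
    using budget mono_eval_x_\<alpha>_pos by (intro sum_mono mult_right_mono) (auto simp: less_imp_le)
  also have "(\<Sum>\<beta>\<in>Delta f. ?l \<beta> 0 * u \<beta>) \<le> mcoeff f 0 - r"
    using cost by (simp add: u_def mult.assoc)
  finally show "r \<le> poly_eval f x"
    by (simp add: poly_eval_x)
qed

end

section \<open>Existence of the critical point\<close>

lemma sgn_prod_real: "sgn (\<Prod>i\<in>A. h i :: real) = (\<Prod>i\<in>A. sgn (h i))"
  by (induction A rule: infinite_finite_induct) (auto simp: sgn_mult)

lemma mono_eval_sgn_exp: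
  "mono_eval (\<chi> i. sgn (v $ i) * exp (y $ i)) \<gamma> = sgn (mono_eval v \<gamma>) * exp (rvec \<gamma> \<bullet> y)"
proof -
  have "mono_eval (\<chi> i. sgn (v $ i) * exp (y $ i)) \<gamma> =
      (\<Prod>i\<in>UNIV. sgn ((v $ i) ^ (\<gamma> $ i))) * (\<Prod>i\<in>UNIV. exp (real (\<gamma> $ i) * y $ i))"
    by (simp add: mono_eval_def power_mult_distrib prod.distrib exp_of_nat_mult)
  also have "(\<Prod>i\<in>UNIV. exp (real (\<gamma> $ i) * y $ i)) = exp (rvec \<gamma> \<bullet> y)"
    by (simp add: inner_vec_def rvec_def exp_sum)
  finally show ?thesis
    by (simp add: mono_eval_def sgn_prod_real)
qed

text \<open>
  The existence of interior exponents makes the Newton polytope full dimensional: the exponents have positive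
  coordinates at every vertex, so by the last condition on ST-polynomials no vertex coefficient vanishes. In
  the orthant of \<open>v\<close> the substitution \<open>x\<^sub>i = sgn v\<^sub>i * exp y\<^sub>i\<close> turns \<open>f\<close> into a signomial in \<open>y\<close> with
  negative coefficients at all exponents in \<open>Delta f\<close>.
\<close>

lemma critical_point_exists:
  fixes f :: "'n::finite rpoly" and \<alpha> :: "nat \<Rightarrow> nat ^ 'n"
  assumes ST: "ST_standard_form \<alpha> f"
    and interior: "\<And>\<beta>. \<beta> \<in> Delta f \<Longrightarrow> rvec \<beta> \<in> interior (newton f)"
    and v: "\<And>i. v $ i \<noteq> 0" "\<And>\<beta>. \<beta> \<in> Delta f \<Longrightarrow> mcoeff f \<beta> * mono_eval v \<beta> < 0"
    and "Delta f \<noteq> {}"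
  shows "\<exists>d x. critical_point_of_ST \<alpha> d x f" and "newton_vertices f = rvec ` \<alpha> ` {..CARD('n)}"
proof -
  let ?V = "rvec ` \<alpha> ` {..CARD('n)}"
  have \<alpha>0: "\<alpha> 0 = 0" and inj: "inj_on \<alpha> {..CARD('n)}" and indep: "\<not> affine_dependent ?V"
    and even: "\<And>j. j \<le> CARD('n) \<Longrightarrow> even_vec (\<alpha> j)" and hull: "rvec ` Delta f \<subseteq> convex hull ?V"
    and coeff_nonneg: "\<And>j. j \<le> CARD('n) \<Longrightarrow> mcoeff f (\<alpha> j) \<ge> 0"
    and coeff_zero: "\<And>j \<beta>. j \<le> CARD('n) \<Longrightarrow> mcoeff f (\<alpha> j) = 0 \<Longrightarrow> \<beta> \<in> Delta f \<Longrightarrow> bary \<alpha> \<beta> j = 0"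
    and repr: "f = (\<Sum>j\<le>CARD('n). Poly_Mapping.single (\<alpha> j) (mcoeff f (\<alpha> j)))
         + (\<Sum>\<beta>\<in>Delta f. Poly_Mapping.single \<beta> (mcoeff f \<beta>))"
    using ST unfolding ST_standard_form_def by blast+
  have "inj_on (\<lambda>j. rvec (\<alpha> j)) {..CARD('n)}"
    using inj by (auto simp: inj_on_def)
  then obtain d where d: "dual_bases (\<lambda>j. rvec (\<alpha> j)) d"
    using dual_bases_exist[of "\<lambda>j. rvec (\<alpha> j)"] \<alpha>0 indep by (auto simp: image_image)
  interpret base: scaled_simplex \<alpha> d "\<chi> i. 1"
    using d even by (intro scaled_simplex.intro scaled_simplex_axioms.intro) auto
  note barycoord = base.barycoord_def

  have keys: "Poly_Mapping.keys f \<subseteq> \<alpha> ` {..CARD('n)} \<union> Delta f"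
  proof
    fix \<gamma> assume "\<gamma> \<in> Poly_Mapping.keys f"
    then have nz: "mcoeff f \<gamma> \<noteq> 0" by (simp add: in_keys_iff)
    have "mcoeff f \<gamma> = (\<Sum>j\<le>CARD('n). mcoeff (Poly_Mapping.single (\<alpha> j) (mcoeff f (\<alpha> j))) \<gamma>) +
        (\<Sum>\<beta>\<in>Delta f. mcoeff (Poly_Mapping.single \<beta> (mcoeff f \<beta>)) \<gamma>)"
      by (subst (1) repr) (simp add: lookup_add lookup_sum)
    also have "\<dots> = 0" if "\<gamma> \<notin> \<alpha> ` {..CARD('n)} \<union> Delta f"
    proof -
      have "(\<Sum>j\<le>CARD('n). mcoeff (Poly_Mapping.single (\<alpha> j) (mcoeff f (\<alpha> j))) \<gamma>) = 0"
        using that by (intro sum.neutral) (auto simp: lookup_single when_def)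
      moreover have "(\<Sum>\<beta>\<in>Delta f. mcoeff (Poly_Mapping.single \<beta> (mcoeff f \<beta>)) \<gamma>) = 0"
        using that by (intro sum.neutral) (auto simp: lookup_single when_def)
      ultimately show ?thesis by simp
    qed
    finally show "\<gamma> \<in> \<alpha> ` {..CARD('n)} \<union> Delta f" using nz by blast
  qed
  have newton_subset: "newton f \<subseteq> convex hull ?V"
    unfolding newton_def
  proof (rule hull_minimal)
    have "rvec ` Poly_Mapping.keys f \<subseteq> ?V \<union> rvec ` Delta f"
      using keys by auto
    then show "rvec ` Poly_Mapping.keys f \<subseteq> convex hull ?V"
      using hull hull_subset[of ?V convex] by blast
  qed (rule convex_convex_hull)
  have barycoord_pos: "base.barycoord (rvec \<beta>) j > 0" if "\<beta> \<in> Delta f" "j \<le> CARD('n)" for \<beta> j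
  proof (rule base.barycoord_pos_interior[OF _ interior[OF that(1)] that(2)])
    fix p assume "p \<in> newton f"
    then show "base.barycoord p j \<ge> 0"
      using newton_subset base.simplex_eq that(2) by (auto simp: image_image)
  qed
  obtain \<beta>0 where \<beta>0: "\<beta>0 \<in> Delta f" using \<open>Delta f \<noteq> {}\<close> by blast
  have coeff_pos: "mcoeff f (\<alpha> j) > 0" if j: "j \<le> CARD('n)" for j
  proof -
    have "bary \<alpha> \<beta>0 j = base.barycoord (rvec \<beta>0) j"
      using \<beta>0 hull j by (intro base.bary_eq_barycoord) auto
    then have "mcoeff f (\<alpha> j) \<noteq> 0"
      using coeff_zero[OF j _ \<beta>0] barycoord_pos[OF \<beta>0 j] by auto
    then show ?thesis using coeff_nonneg[OF j] by simp
  qed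
  have "newton f = convex hull ?V"
  proof (rule antisym[OF newton_subset])
    have "\<alpha> ` {..CARD('n)} \<subseteq> Poly_Mapping.keys f"
    proof
      fix \<gamma> assume "\<gamma> \<in> \<alpha> ` {..CARD('n)}"
      then obtain j where "j \<le> CARD('n)" "\<gamma> = \<alpha> j" by blast
      then show "\<gamma> \<in> Poly_Mapping.keys f"
        using coeff_pos[of j] by (simp add: in_keys_iff)
    qed
    then show "convex hull ?V \<subseteq> newton f"
      unfolding newton_def by (intro hull_mono image_mono)
  qed
  then show "newton_vertices f = ?V"
    using extreme_point_of_convex_hull_affine_independent[OF indep] by (auto simp: newton_vertices_def)

  have sum_barycoord: "(\<Sum>j\<in>{1..CARD('n)}. rvec \<beta> \<bullet> d j) < 1" if "\<beta> \<in> Delta f" for \<beta>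
    using barycoord_pos[OF that, of 0] by (simp add: barycoord)
  have "\<exists>y. \<forall>j\<in>{1..CARD('n)}. mcoeff f (\<alpha> j) * exp (rvec (\<alpha> j) \<bullet> y) =
      (\<Sum>\<beta>\<in>Delta f. \<bar>mcoeff f \<beta>\<bar> * (rvec \<beta> \<bullet> d j) * exp (rvec \<beta> \<bullet> y))"
  proof (rule base.signomial_critical_point[OF finite_Delta \<open>Delta f \<noteq> {}\<close>])
    fix \<beta> j assume "\<beta> \<in> Delta f" "j \<in> {1..CARD('n)}"
    then show "rvec \<beta> \<bullet> d j > 0"
      using barycoord_pos[of \<beta> j] by (simp add: barycoord)
  qed (use coeff_pos sum_barycoord in \<open>auto simp: Delta_def\<close>)
  then obtain y where y: "\<And>j. j \<in> {1..CARD('n)} \<Longrightarrow> mcoeff f (\<alpha> j) * exp (rvec (\<alpha> j) \<bullet> y) =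
      (\<Sum>\<beta>\<in>Delta f. \<bar>mcoeff f \<beta>\<bar> * (rvec \<beta> \<bullet> d j) * exp (rvec \<beta> \<bullet> y))"
    by blast
  define x where "x = (\<chi> i. sgn (v $ i) * exp (y $ i))"
  have x: "mono_eval x \<gamma> = sgn (mono_eval v \<gamma>) * exp (rvec \<gamma> \<bullet> y)" for \<gamma>
    by (simp add: x_def mono_eval_sgn_exp)
  have neg: "mcoeff f \<beta> * mono_eval x \<beta> = - (\<bar>mcoeff f \<beta>\<bar> * exp (rvec \<beta> \<bullet> y))" if "\<beta> \<in> Delta f" for \<beta>
    using v(2)[OF that] by (auto simp: x sgn_if mult_less_0_iff)
  have "critical_point_of_ST \<alpha> d x f"
  proof (intro critical_point_of_ST.intro scaled_simplex.intro scaled_simplex_axioms.intro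
      critical_point_of_ST_axioms.intro)
    show "x $ i \<noteq> 0" for i using v(1) by (simp add: x_def sgn_zero_iff)
    show "mcoeff f \<beta> * mono_eval x \<beta> < 0" if "\<beta> \<in> Delta f" for \<beta>
    proof -
      have "mcoeff f \<beta> \<noteq> 0" using that by (auto simp: Delta_def)
      then show ?thesis by (simp add: neg[OF that])
    qed
    fix j assume j: "j \<in> {1..CARD('n)}"
    have "mono_eval v (\<alpha> j) > 0"
      using mono_eval_even_nonneg[OF even, of j v] mono_eval_nonzero[of v "\<alpha> j"] v(1) j by (simp add: less_le)
    then have "mcoeff f (\<alpha> j) * mono_eval x (\<alpha> j) =
        (\<Sum>\<beta>\<in>Delta f. \<bar>mcoeff f \<beta>\<bar> * (rvec \<beta> \<bullet> d j) * exp (rvec \<beta> \<bullet> y))"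
      using y[OF j] by (simp add: x)
    also have "\<dots> = (\<Sum>\<beta>\<in>Delta f. - (mcoeff f \<beta> * mono_eval x \<beta>) * base.barycoord (rvec \<beta>) j)"
      using j by (intro sum.cong refl) (simp add: neg barycoord)
    finally show "mcoeff f (\<alpha> j) * mono_eval x (\<alpha> j) =
        (\<Sum>\<beta>\<in>Delta f. - (mcoeff f \<beta> * mono_eval x \<beta>) * base.barycoord (rvec \<beta>) j)" .
  qed (use d ST even barycoord_pos in auto)
  then show "\<exists>d x. critical_point_of_ST \<alpha> d x f" by blast
qed

section \<open>ST-polynomials that are sums of monomial squares\<close>

lemma monomial_square_sos:
  fixes \<gamma> :: "nat ^ 'n::finite" and c :: real
  assumes "even_vec \<gamma>" "c \<ge> 0"
  shows "\<exists>gs. Poly_Mapping.single \<gamma> c = sum_list (map (\<lambda>g. g ^ 2) gs)"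
proof -
  define \<delta> :: "nat ^ 'n" where "\<delta> = (\<chi> i. \<gamma> $ i div 2)"
  have "\<gamma> $ i = \<gamma> $ i div 2 + \<gamma> $ i div 2" for i
    using assms(1) by (simp add: even_vec_def flip: mult_2)
  then have "\<gamma> = \<delta> + \<delta>" by (simp add: \<delta>_def vec_eq_iff)
  then have "Poly_Mapping.single \<gamma> c = sum_list (map (\<lambda>g. g ^ 2) [Poly_Mapping.single \<delta> (sqrt c)])"
    using assms(2) by (simp add: power2_eq_square mult_single)
  then show ?thesis by blast
qed

text \<open>
  The minimum is \<open>f(0)\<close> and the remaining monomial squares are certificates of either kind. Some vertex
  coefficients may vanish here, so the Newton polytope can be a proper face of the simplex; an exponent
  occurring in \<open>f\<close> is still a vertex of the simplex and hence of every convex subset containing it.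
\<close>

lemma bounds_without_Delta:
  fixes f :: "'n::finite rpoly" and \<alpha> :: "nat \<Rightarrow> nat ^ 'n"
  assumes ST: "ST_standard_form \<alpha> f" and no_Delta: "Delta f = {}"
  shows "f_inf f = ereal (mcoeff f 0)" "gp_circuit f = ereal (mcoeff f 0)"
    "gp_program \<alpha> f = ereal (mcoeff f 0)" "f_sos f = ereal (mcoeff f 0)"
proof -
  let ?V = "rvec ` \<alpha> ` {..CARD('n)}"
  let ?I = "{1..CARD('n)}"
  have \<alpha>0: "\<alpha> 0 = 0" and inj: "inj_on \<alpha> {..CARD('n)}" and indep: "\<not> affine_dependent ?V"
    and even: "\<And>j. j \<le> CARD('n) \<Longrightarrow> even_vec (\<alpha> j)"
    and coeff_nonneg: "\<And>j. j \<le> CARD('n) \<Longrightarrow> mcoeff f (\<alpha> j) \<ge> 0"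
    and repr: "f = (\<Sum>j\<le>CARD('n). Poly_Mapping.single (\<alpha> j) (mcoeff f (\<alpha> j)))"
    using ST no_Delta unfolding ST_standard_form_def by auto
  have "{..CARD('n)} = insert 0 ?I" by auto
  then have diff: "f - const_poly (mcoeff f 0) = (\<Sum>j\<in>?I. Poly_Mapping.single (\<alpha> j) (mcoeff f (\<alpha> j)))"
    by (subst (1) repr) (simp add: \<alpha>0)
  have nonneg: "poly_eval (Poly_Mapping.single (\<alpha> j) (mcoeff f (\<alpha> j))) z \<ge> 0" if "j \<in> ?I" for j z
    using that coeff_nonneg[of j] mono_eval_even_nonneg[OF even, of j z] by (simp add: poly_eval_coeff_sum)
  have at_zero: "mono_eval 0 (\<alpha> j) = 0" if "j \<in> ?I" for j
  proof -
    have "\<alpha> j \<noteq> 0"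
      using inj_onD[OF inj, of j 0] that \<alpha>0 by auto
    then obtain i where "\<alpha> j $ i \<noteq> 0" by (auto simp: vec_eq_iff)
    then show ?thesis
      unfolding mono_eval_def by (intro prod_zero) (auto intro!: bexI[of _ i])
  qed
  have eval: "poly_eval f z = mcoeff f 0 + (\<Sum>j\<in>?I. poly_eval (Poly_Mapping.single (\<alpha> j) (mcoeff f (\<alpha> j))) z)" for z
  proof -
    have "poly_eval f z - mcoeff f 0 = poly_eval (f - const_poly (mcoeff f 0)) z"
      by (simp add: poly_eval_diff)
    then show ?thesis
      unfolding diff by (simp add: poly_eval_coeff_sum coeff_sum_sum)
  qed
  have eval0: "poly_eval f 0 = mcoeff f 0"
  proof -
    have "(\<Sum>j\<in>?I. poly_eval (Poly_Mapping.single (\<alpha> j) (mcoeff f (\<alpha> j))) 0) = 0"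
      by (intro sum.neutral) (simp add: poly_eval_coeff_sum at_zero)
    then show ?thesis by (simp only: eval)
  qed
  show "f_inf f = ereal (mcoeff f 0)"
    by (rule f_inf_eqI[OF _ eval0]) (use nonneg in \<open>auto simp: eval intro!: sum_nonneg\<close>)

  have "\<exists>gs. f - const_poly (mcoeff f 0) = sum_list (map (\<lambda>g. g ^ 2) gs)"
    unfolding diff using even coeff_nonneg by (intro sum_of_sos monomial_square_sos) auto
  then show "f_sos f = ereal (mcoeff f 0)"
    using f_sos_eqI[of f 0] unfolding eval0 by blast

  have "gp_feasible \<alpha> f a r \<longleftrightarrow> r \<le> mcoeff f 0" for a r
    using coeff_nonneg by (auto simp: gp_feasible_def no_Delta)
  then show "gp_program \<alpha> f = ereal (mcoeff f 0)"
    unfolding gp_program_def by (intro SUP_ereal_attained) auto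

  define J where "J = {j \<in> ?I. mcoeff f (\<alpha> j) > 0}"
  have diff_J: "f - const_poly (mcoeff f 0) = (\<Sum>j\<in>J. Poly_Mapping.single (\<alpha> j) (mcoeff f (\<alpha> j)))"
    unfolding diff
  proof (rule sum.mono_neutral_right)
    show "\<forall>j\<in>?I - J. Poly_Mapping.single (\<alpha> j) (mcoeff f (\<alpha> j)) = 0"
      using coeff_nonneg by (force simp: J_def less_le)
  qed (auto simp: J_def)
  obtain gs where gs: "set gs = (\<lambda>j. Poly_Mapping.single (\<alpha> j) (mcoeff f (\<alpha> j))) ` J"
      "sum_list gs = (\<Sum>j\<in>J. Poly_Mapping.single (\<alpha> j) (mcoeff f (\<alpha> j)))"
    using sum_list_of_sum[of J] by (auto simp: J_def)
  have "Poly_Mapping.keys f \<subseteq> \<alpha> ` {..CARD('n)}"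
  proof
    fix \<gamma> assume "\<gamma> \<in> Poly_Mapping.keys f"
    then have "(\<Sum>j\<le>CARD('n). mcoeff (Poly_Mapping.single (\<alpha> j) (mcoeff f (\<alpha> j))) \<gamma>) \<noteq> 0"
      by (subst (asm) (1) repr) (simp add: in_keys_iff lookup_sum)
    then show "\<gamma> \<in> \<alpha> ` {..CARD('n)}"
      by (rule contrapos_np) (auto intro!: sum.neutral simp: lookup_single when_def)
  qed
  then have newton_subset: "newton f \<subseteq> convex hull ?V"
    unfolding newton_def by (intro hull_mono image_mono)
  have "gp_circuit f = ereal (poly_eval f 0)"
  proof (rule gp_circuit_eqI)
    show "f - const_poly (poly_eval f 0) = sum_list gs"
      by (simp only: eval0 diff_J gs)
    fix g assume "g \<in> set gs"
    then obtain j where j: "j \<in> J" and g: "g = Poly_Mapping.single (\<alpha> j) (mcoeff f (\<alpha> j))"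
      using gs(1) by blast
    have jI: "j \<in> ?I" "j \<le> CARD('n)" and pos: "mcoeff f (\<alpha> j) > 0" using j by (auto simp: J_def)
    have Delta_g: "Delta g = {}"
      using pos even[OF jI(2)] by (auto simp: Delta_def g lookup_single when_def)
    have "ST_standard_form \<alpha> g"
      unfolding ST_standard_form_def Delta_g
    proof (intro conjI)
      have "(\<Sum>i\<le>CARD('n). Poly_Mapping.single (\<alpha> i) (mcoeff g (\<alpha> i))) = (\<Sum>i\<le>CARD('n). if i = j then g else 0)"
        using inj_on_eq_iff[OF inj, of j] jI(2) by (intro sum.cong) (auto simp: g lookup_single when_def)
      then show "g = (\<Sum>i\<le>CARD('n). Poly_Mapping.single (\<alpha> i) (mcoeff g (\<alpha> i))) +
          (\<Sum>\<beta>\<in>{}. Poly_Mapping.single \<beta> (mcoeff g \<beta>))"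
        using jI(2) by simp
      show "\<forall>i\<le>CARD('n). mcoeff g (\<alpha> i) \<ge> 0 \<and> (mcoeff g (\<alpha> i) = 0 \<longrightarrow> (\<forall>\<beta>\<in>{}. bary \<alpha> \<beta> i = 0))"
        using pos by (auto simp: g lookup_single when_def)
    qed (use \<alpha>0 inj indep even in auto)
    then have "circuit_poly g" using Delta_g by (auto simp: circuit_poly_def)
    moreover have "nonneg_poly g"
      using nonneg[OF jI(1)] by (simp add: nonneg_poly_def g)
    moreover have "newton g face_of convex hull ({0} \<union> newton_vertices f)"
    proof -
      have newton_g: "newton g = {rvec (\<alpha> j)}"
        using pos by (simp add: newton_def g)
      have face: "{rvec (\<alpha> j)} face_of convex hull ?V"
        using jI(2) by (simp add: face_of_singleton extreme_point_of_convex_hull_affine_independent[OF indep])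
      have in_newton: "rvec (\<alpha> j) \<in> newton f"
        unfolding newton_def using pos by (intro hull_inc) (auto simp: in_keys_iff)
      have "{rvec (\<alpha> j)} face_of newton f"
        using face_of_subset[OF face _ newton_subset] in_newton by simp
      then have "rvec (\<alpha> j) \<in> newton_vertices f"
        by (simp add: newton_vertices_def face_of_singleton)
      moreover have "{0} \<union> newton_vertices f \<subseteq> convex hull ?V"
      proof -
        have "rvec (\<alpha> 0) \<in> convex hull ?V" by (intro hull_inc) auto
        moreover have "newton_vertices f \<subseteq> newton f"
          by (auto simp: newton_vertices_def extreme_point_of_def)
        ultimately show ?thesis using newton_subset by (auto simp: \<alpha>0)
      qed
      then have "convex hull ({0} \<union> newton_vertices f) \<subseteq> convex hull ?V"
        by (rule hull_minimal) (rule convex_convex_hull)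
      ultimately show ?thesis
        unfolding newton_g by (intro face_of_subset[OF face]) (auto intro: hull_inc)
    qed
    ultimately show "circuit_poly g \<and> nonneg_poly g \<and>
         newton g face_of convex hull ({0} \<union> newton_vertices f)"
      by blast
  qed
  then show "gp_circuit f = ereal (mcoeff f 0)"
    by (simp only: eval0)
qed

theorem corollary3p6:
  fixes f :: "'n::finite rpoly" and \<alpha> :: "nat \<Rightarrow> nat ^ 'n"
  assumes "ST_standard_form \<alpha> f"
    and "\<forall>\<beta>\<in>Delta f. rvec \<beta> \<in> interior (newton f)"
    and "\<exists>v :: real ^ 'n. (\<forall>i. v $ i \<noteq> 0) \<and> (\<forall>\<beta>\<in>Delta f. mcoeff f \<beta> * mono_eval v \<beta> < 0)"
  shows "(gp_circuit f = f_inf f \<and> gp_program \<alpha> f = f_inf f) \<and>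
    (rvec ` Delta f \<subseteq> med_star (newton_vertices f) \<longrightarrow> f_sos f = f_inf f)"
proof (cases "Delta f = {}")
  case True
  then show ?thesis
    using bounds_without_Delta[OF assms(1)] by simp
next
  case False
  obtain v where v: "\<And>i. v $ i \<noteq> 0" "\<And>\<beta>. \<beta> \<in> Delta f \<Longrightarrow> mcoeff f \<beta> * mono_eval v \<beta> < 0"
    using assms(3) by blast
  have interior: "\<And>\<beta>. \<beta> \<in> Delta f \<Longrightarrow> rvec \<beta> \<in> interior (newton f)"
    using assms(2) by blast
  note crit = critical_point_exists[OF assms(1) interior v False]
  obtain d x where "critical_point_of_ST \<alpha> d x f" using crit(1) by blast
  then interpret critical_point_of_ST \<alpha> d x f .
  show ?thesis
    using gp_circuit_eq[OF crit(2)] gp_program_eq f_sos_eq f_inf_eq by (simp add: crit(2))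
qed

end
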